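(* Let $X=X(a_1,\ldots,a_c)\subset\mathbb{P}^n$ be a complete intersection such that $\operatorname{reg} X\le \dim X$ (equivalently, $\sum_{i=1}^c a_i\le n$). Then the Hilbert polynomial of $X$ recovers the degree sequence: if $Y=X(b_1,\ldots,b_{c'})\subset\mathbb{P}^n$ is a complete intersection with the same Hilbert polynomial as $X$, then $c'=c$ and $(b_1,\ldots,b_{c})$ is a permutation of $(a_1,\ldots,a_c)$.
   Context: Fix an algebraically closed ground field $k$ of characteristic zero. For positive integers $a_1,\ldots,a_c$ and $n\ge c\geq 1$, a complete intersection $X=X(a_1,\ldots,a_c)\subset\mathbb{P}^n_k$ of codimension $c$ is a closed subscheme of codimension $c$ whose defining ideal is generated by $c$ homogeneous polynomials $f_1,\ldots,f_c\in S=k[x_0,\ldots,x_n]$ (a regular sequence) with $\deg f_i=a_i$; $(a_1,\ldots,a_c)$ is its degree sequence, considered up to permutation. Here $\operatorname{reg}X$ denotes the Castelnuovo–Mumford regularity of the homogeneous coordinate ring $S_X=S/(f_1,\ldots,f_c)$ as a graded $S$-module, and $\dim X=n-c$. *)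

theory Defs
  imports
    "HOL-Library.Poly_Mapping"
    "HOL-Library.Extended_Real"
    "HOL-Library.Cardinality"
    "HOL-Computational_Algebra.Polynomial"
    "Jordan_Normal_Form.Matrix"
begin

text \<open>
  The polynomial ring \<open>S\<close> is the ring of finitely supported functions from exponent vectors to
  coefficients; the variables are indexed by a finite type \<open>'v\<close>, so \<open>CARD('v) = n + 1\<close> for
  \<open>S = k[x\<^sub>0, \<dots>, x\<^sub>n]\<close>.
\<close>

type_synonym ('v, 'k) mpoly = "('v \<Rightarrow>\<^sub>0 nat) \<Rightarrow>\<^sub>0 'k"

definition monom_degree :: "('v::finite \<Rightarrow>\<^sub>0 nat) \<Rightarrow> nat" where
  "monom_degree m = (\<Sum>v\<in>UNIV. Poly_Mapping.lookup m v)"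

text \<open>
  Degrees are integers because of twists; the zero polynomial is homogeneous of every degree, and
  it is the only homogeneous polynomial of negative degree.
\<close>

definition homogeneous :: "int \<Rightarrow> ('v::finite, 'k::zero) mpoly \<Rightarrow> bool" where
  "homogeneous d p \<longleftrightarrow> (\<forall>m\<in>Poly_Mapping.keys p. int (monom_degree m) = d)"


subsection \<open>Ideals\<close>

text \<open>Ideals are submodules of the ring regarded as a module over itself.\<close>

abbreviation is_ideal :: "'a::comm_ring_1 set \<Rightarrow> bool" where
  "is_ideal \<equiv> Modules.module.subspace (*)"

abbreviation ideal_generated_by :: "'a::comm_ring_1 set \<Rightarrow> 'a set" where
  "ideal_generated_by \<equiv> Modules.module.span (*)"

definition homogeneous_ideal :: "('v::finite, 'k::comm_ring_1) mpoly set \<Rightarrow> bool" where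
  "homogeneous_ideal I \<longleftrightarrow> is_ideal I \<and> I = ideal_generated_by {p \<in> I. \<exists>d. homogeneous d p}"

definition is_prime_ideal :: "'a::comm_ring_1 set \<Rightarrow> bool" where
  "is_prime_ideal P \<longleftrightarrow>
     is_ideal P \<and> 1 \<notin> P \<and> (\<forall>x y. x * y \<in> P \<longrightarrow> x \<in> P \<or> y \<in> P)"

definition irrelevant_ideal :: "('v, 'k::zero) mpoly set" where
  "irrelevant_ideal = {p. Poly_Mapping.lookup p 0 = 0}"


subsection \<open>Dimension of the projective scheme of a homogeneous ideal\<close>

text \<open>
  Points of \<open>Proj (S/I)\<close> are the homogeneous primes containing \<open>I\<close> but not the irrelevant ideal,
  and irreducible closed subsets are the closures of points.  The empty scheme gets dimension
  \<open>-\<infinity>\<close>.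
\<close>

definition proj_points :: "('v::finite, 'k::comm_ring_1) mpoly set \<Rightarrow> ('v, 'k) mpoly set set" where
  "proj_points I = {P. homogeneous_ideal P \<and> is_prime_ideal P \<and> I \<subseteq> P \<and> \<not> irrelevant_ideal \<subseteq> P}"

definition proj_dim :: "('v::finite, 'k::comm_ring_1) mpoly set \<Rightarrow> ereal" where
  "proj_dim I = Sup {ereal (real r) | r P.
     (\<forall>i\<le>r. P i \<in> proj_points I) \<and> (\<forall>i<r. P i \<subset> P (Suc i))}"


subsection \<open>Hilbert function and Hilbert polynomial of \<open>S/I\<close>\<close>

text \<open>
  The dimension over \<open>k\<close>; constants embed into \<open>S\<close> as \<open>Poly_Mapping.single 0 c\<close>.
\<close>

definition vdim :: "('v, 'k::field) mpoly set \<Rightarrow> nat" where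
  "vdim = Vector_Spaces.vector_space.dim (\<lambda>c p. Poly_Mapping.single 0 c * p)"

text \<open>
  \<open>(S/I)\<^sub>d = S\<^sub>d / (I \<inter> S\<^sub>d)\<close>, where \<open>S\<^sub>d\<close> is finite-dimensional.
\<close>

definition hilbert_function :: "('v::finite, 'k::field) mpoly set \<Rightarrow> nat \<Rightarrow> nat" where
  "hilbert_function I d =
     vdim {p :: ('v, 'k) mpoly. homogeneous (int d) p} - vdim {p \<in> I. homogeneous (int d) p}"

definition hilbert_polynomial :: "('v::finite, 'k::field) mpoly set \<Rightarrow> rat poly" where
  "hilbert_polynomial I =
     (THE P. \<exists>d0. \<forall>d\<ge>d0. poly P (of_nat d) = of_nat (hilbert_function I d))"


subsection \<open>Castelnuovo--Mumford regularity of \<open>S/I\<close>\<close>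

text \<open>
  A minimal graded free resolution
  \<open>\<dots> \<rightarrow> F\<^sub>1 \<rightarrow> F\<^sub>0 \<rightarrow> S/I \<rightarrow> 0\<close> with \<open>F\<^sub>i = \<Oplus>\<^sub>p S(-\<delta> i ! p)\<close>, i.e. \<open>\<delta> i\<close> lists the degrees of a
  homogeneous basis of \<open>F\<^sub>i\<close>.  The matrix \<open>D i\<close> represents \<open>F\<^sub>i\<^sub>+\<^sub>1 \<rightarrow> F\<^sub>i\<close> on column vectors, and
  the augmentation \<open>F\<^sub>0 \<rightarrow> S/I\<close> maps the \<open>p\<close>-th basis vector to the class of \<open>\<epsilon> $ p\<close>.  Minimality
  means that the image of \<open>F\<^sub>i\<^sub>+\<^sub>1\<close> lies in the irrelevant ideal times \<open>F\<^sub>i\<close>.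
\<close>

definition minimal_free_resolution ::
  "('v::finite, 'k::comm_ring_1) mpoly set \<Rightarrow> (nat \<Rightarrow> int list) \<Rightarrow>
   ('v, 'k) mpoly vec \<Rightarrow> (nat \<Rightarrow> ('v, 'k) mpoly mat) \<Rightarrow> bool" where
  "minimal_free_resolution I \<delta> \<epsilon> D \<longleftrightarrow>
     \<comment> \<open>graded maps of degree 0\<close>
     \<epsilon> \<in> carrier_vec (length (\<delta> 0)) \<and>
     (\<forall>p<length (\<delta> 0). homogeneous (\<delta> 0 ! p) (\<epsilon> $ p)) \<and>
     (\<forall>i. D i \<in> carrier_mat (length (\<delta> i)) (length (\<delta> (Suc i)))) \<and>
     (\<forall>i. \<forall>p<length (\<delta> i). \<forall>q<length (\<delta> (Suc i)).
        homogeneous (\<delta> (Suc i) ! q - \<delta> i ! p) (D i $$ (p, q))) \<and>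
     \<comment> \<open>exactness at \<open>S/I\<close>, at \<open>F\<^sub>0\<close>, and at all later terms\<close>
     (\<forall>s. \<exists>v\<in>carrier_vec (length (\<delta> 0)). s - \<epsilon> \<bullet> v \<in> I) \<and>
     {v \<in> carrier_vec (length (\<delta> 0)). \<epsilon> \<bullet> v \<in> I} =
       (\<lambda>w. D 0 *\<^sub>v w) ` carrier_vec (length (\<delta> 1)) \<and>
     (\<forall>i. {v \<in> carrier_vec (length (\<delta> (Suc i))). D i *\<^sub>v v = 0\<^sub>v (length (\<delta> i))} =
       (\<lambda>w. D (Suc i) *\<^sub>v w) ` carrier_vec (length (\<delta> (Suc (Suc i))))) \<and>
     \<comment> \<open>minimality\<close>
     (\<forall>i. \<forall>p<length (\<delta> i). \<forall>q<length (\<delta> (Suc i)). D i $$ (p, q) \<in> irrelevant_ideal)"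

text \<open>
  The regularity is the largest \<open>j - i\<close> such that a minimal graded free resolution has a basis
  element of degree \<open>j\<close> in homological degree \<open>i\<close>; it does not depend on the resolution.  The zero
  module has regularity \<open>-\<infinity>\<close>.
\<close>

definition regularity :: "('v::finite, 'k::comm_ring_1) mpoly set \<Rightarrow> ereal" where
  "regularity I = (THE r. \<exists>\<delta> \<epsilon> D. minimal_free_resolution I \<delta> \<epsilon> D \<and>
     r = Sup {ereal (real_of_int (j - int i)) | i j. j \<in> set (\<delta> i)})"


subsection \<open>Complete intersections\<close>

definition regular_sequence :: "'a::comm_ring_1 list \<Rightarrow> bool" where
  "regular_sequence fs \<longleftrightarrow>
     (\<forall>i<length fs. \<forall>g. fs ! i * g \<in> ideal_generated_by (set (take i fs)) \<longrightarrow>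
        g \<in> ideal_generated_by (set (take i fs))) \<and>
     1 \<notin> ideal_generated_by (set fs)"

text \<open>
  A closed subscheme of \<open>\<P>\<^sup>n\<close>, where \<open>CARD('v) = n + 1\<close>, is represented by its defining ideal
  \<open>I\<close>; the list \<open>as\<close> is the degree sequence and its length the codimension.  The dimension clause
  expresses that the codimension is \<open>length as\<close>; it also follows from the regular sequence.
\<close>

definition complete_intersection ::
  "nat \<Rightarrow> nat list \<Rightarrow> ('v::finite, 'k::field) mpoly set \<Rightarrow> bool" where
  "complete_intersection n as I \<longleftrightarrow>
     1 \<le> length as \<and> length as \<le> n \<and> (\<forall>a\<in>set as. 0 < a) \<and>
     proj_dim I = ereal (real (n - length as)) \<and>
     (\<exists>fs. length fs = length as \<and>
        (\<forall>i<length as. homogeneous (int (as ! i)) (fs ! i)) \<and>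
        regular_sequence fs \<and> I = ideal_generated_by (set fs))"

end

theory Submission
  imports
    Defs
    "HOL-Computational_Algebra.Formal_Power_Series"
    "HOL-Computational_Algebra.Polynomial_FPS"
begin

text \<open>
  Let \<open>S = k[x\<^sub>0, \<dots>, x\<^sub>n]\<close> and let \<open>X\<close> be defined by a
  regular sequence of forms of positive degrees \<open>a\<^sub>1, \<dots>, a\<^sub>c\<close>. The
  statement has two parts, and both follow by adding one form \<open>f\<close> of degree
  \<open>a\<close> at a time: if \<open>f\<close> is a nonzerodivisor on \<open>S/J\<close>, then
  \<open>0 \<rightarrow> (S/J)(-a) \<rightarrow> S/J \<rightarrow> S/(J + fS) \<rightarrow>
  0\<close> is exact.

  Regularity. If \<open>F\<close> is a minimal free resolution of \<open>S/J\<close>, the mapping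
  cone of \<open>f: F(-a) \<rightarrow> F\<close> is one of \<open>S/(J + fS)\<close>
  (\<open>mapping_cone\<close>); iteration yields the Koszul complex, whose largest value of degree
  minus homological degree is \<open>a\<^sub>1 + \<dots> + a\<^sub>c - c\<close>. The regularity is
  defined by an arbitrary minimal resolution, so its value also needs the uniqueness of the degrees.
  Two resolutions admit graded comparison maps \<open>\<phi>\<close> and \<open>\<psi>\<close> in
  both directions; \<open>\<psi>\<phi>\<close> is homotopic to the identity, and by minimality a
  null-homotopic map has all its entries in the irrelevant ideal. A basis element whose degree is
  missing from the other resolution would have the constant terms of its column in
  \<open>\<phi>\<close> all zero for degree reasons, and then \<open>1\<close> would lie in the
  irrelevant ideal (\<open>resolution_degrees_subset\<close>). Hence \<open>reg X = a\<^sub>1 +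
  \<dots> + a\<^sub>c - c\<close>, and comparison with \<open>dim X = n - c\<close> gives the
  equivalence.

  Hilbert polynomial. The exact sequence multiplies the Hilbert series by \<open>1 -
  t\<^sup>a\<close>, so that of \<open>X\<close> is \<open>N\<^sub>X(t) / (1 -
  t)\<^sup>n\<^sup>+\<^sup>1\<close> with \<open>N\<^sub>X = \<Prod>(1 - t\<^sup>a)\<close>, the
  product being over the degrees. Equal Hilbert polynomials mean that the Hilbert series differ by a
  polynomial, that is, \<open>(1 - t)\<^sup>n\<^sup>+\<^sup>1\<close> divides \<open>N\<^sub>X -
  N\<^sub>Y\<close>. Write \<open>N\<^sub>X = (1 - t)\<^sup>c Q\<^sub>X\<close>, where
  \<open>Q\<^sub>X(1)\<close> is the product of the degrees and hence nonzero. Comparing the orders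
  of vanishing at \<open>t = 1\<close> gives \<open>c = c'\<close>; comparing values and derivatives
  of \<open>Q\<^sub>X\<close> and \<open>Q\<^sub>Y\<close> at \<open>1\<close> gives equal products
  and equal sums of the degrees. (If \<open>c = n\<close> the derivative is not determined, but then
  all \<open>a\<^sub>i\<close> equal \<open>1\<close>, and so do all \<open>b\<^sub>i\<close>, since
  their product is \<open>1\<close>.) Therefore \<open>N\<^sub>Y\<close>, too, has degree at most
  \<open>n\<close>, and a polynomial of degree at most \<open>n\<close> that is divisible by
  \<open>(1 - t)\<^sup>n\<^sup>+\<^sup>1\<close> vanishes: \<open>N\<^sub>X = N\<^sub>Y\<close>.
  Finally \<open>\<Prod>(1 - t\<^sup>a)\<close> determines the multiset of its exponents, since the
  lowest term of the product minus \<open>1\<close> reveals the smallest exponent and its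
  multiplicity (\<open>degrees_determined\<close>, \<open>ci_numerator_inject\<close>).
\<close>

section \<open>Linear algebra\<close>

context vector_space
begin

lemma independent_Un:
  assumes "finite A" "finite B" "independent A" "independent B" "span A \<inter> span B \<subseteq> {0}"
  shows "independent (A \<union> B)" and "A \<inter> B = {}"
proof -
  show disj: "A \<inter> B = {}"
  proof (rule ccontr)
    assume "A \<inter> B \<noteq> {}"
    then obtain x where x: "x \<in> A" "x \<in> B" by blast
    then have "x = 0" using assms(5) span_base by blast
    then show False using x(1) assms(3) dependent_zero by blast
  qed
  show "independent (A \<union> B)"
  proof
    assume "dependent (A \<union> B)"
    then obtain u v where v: "v \<in> A \<union> B" "u v \<noteq> 0" and s: "(\<Sum>x\<in>A \<union> B. scale (u x) x) = 0"
      using dependent_finite[of "A \<union> B"] assms(1,2) by auto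
    let ?a = "\<Sum>x\<in>A. scale (u x) x" and ?b = "\<Sum>x\<in>B. scale (u x) x"
    have ab: "?a + ?b = 0" using s disj assms(1,2) by (simp add: sum.union_disjoint)
    have "?a \<in> span A" "?b \<in> span B" by (auto intro!: span_sum intro: span_scale span_base)
    moreover have "?a = - ?b" using ab by (simp add: eq_neg_iff_add_eq_0)
    ultimately have "?a \<in> span A \<inter> span B" using span_neg by auto
    then have "?a = 0" "?b = 0" using assms(5) ab by auto
    then show False using v assms(1-4) independentD[of A A u v] independentD[of B B u v] by auto
  qed
qed

lemma span_Int_independent_Un:
  assumes "finite A" "finite B" "independent (A \<union> B)" "A \<inter> B = {}"
  shows "span A \<inter> span B \<subseteq> {0}"
proof
  fix x assume "x \<in> span A \<inter> span B"
  then obtain u w where u: "x = (\<Sum>v\<in>A. scale (u v) v)" and w: "x = (\<Sum>v\<in>B. scale (w v) v)"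
    unfolding span_finite[OF assms(1)] span_finite[OF assms(2)] by blast
  let ?c = "\<lambda>v. if v \<in> A then u v else - w v"
  have "(\<Sum>v\<in>A \<union> B. scale (?c v) v) = (\<Sum>v\<in>A. scale (?c v) v) + (\<Sum>v\<in>B. scale (?c v) v)"
    by (rule sum.union_disjoint[OF assms(1,2,4)])
  also have "(\<Sum>v\<in>A. scale (?c v) v) = x" using u by simp
  also have "(\<Sum>v\<in>B. scale (?c v) v) = (\<Sum>v\<in>B. - scale (w v) v)"
    using assms(4) by (intro sum.cong refl) auto
  also have "\<dots> = - x" using w by (simp add: sum_negf)
  finally have z: "(\<Sum>v\<in>A \<union> B. scale (?c v) v) = 0" by simp
  have "u v = 0" if "v \<in> A" for v
    using independentD[OF assms(3) _ subset_refl z, of v] that assms(1,2) by simp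
  then show "x \<in> {0}" using u by simp
qed

lemma finite_independent_subset_span:
  assumes "independent B" "B \<subseteq> span G" "finite G"
  shows "finite B"
  using independent_span_bound[OF assms(3,1,2)] by simp

text \<open>
  The rank-nullity theorem for the map from \<open>V\<close> to the quotient by \<open>W\<close>
  that \<open>T\<close> induces, stated without quotients. It is applied with \<open>T\<close> the
  multiplication by a form and \<open>W\<close> a graded piece of an ideal. A basis \<open>C\<close>
  of the kernel is extended by \<open>E\<close> to a basis of \<open>V\<close>; then \<open>T `
  E\<close> extends a basis of \<open>W\<close> to one of \<open>W + T V\<close>.
\<close>

lemma dim_plus_image:
  assumes T: "Vector_Spaces.linear scale scale T"
    and W: "subspace W" "W \<subseteq> span G" "finite G"
    and V: "subspace V" "V \<subseteq> span H" "finite H"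
  shows "dim {w + T v | w v. w \<in> W \<and> v \<in> V} + dim {v \<in> V. T v \<in> W} = dim W + dim V"
proof -
  interpret T: Vector_Spaces.linear scale scale T by (fact T)
  let ?U = "{v \<in> V. T v \<in> W}"
  have U: "subspace ?U"
  proof -
    have "?U = V \<inter> {v. T v \<in> W}" by blast
    then show ?thesis using subspace_inter[OF V(1) T.subspace_linear_preimage[OF W(1)]] by simp
  qed
  obtain B where B: "B \<subseteq> W" "independent B" "W \<subseteq> span B" by (rule maximal_independent_subset)
  obtain C where C: "C \<subseteq> ?U" "independent C" "?U \<subseteq> span C" by (rule maximal_independent_subset)
  have "C \<subseteq> V" using C(1) by blast
  then obtain S where S: "C \<subseteq> S" "S \<subseteq> V" "independent S" "V \<subseteq> span S"
    using C(2) by (rule maximal_independent_subset_extend)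
  have fB: "finite B" using finite_independent_subset_span[OF B(2) _ W(3)] B(1) W(2) by blast
  have fS: "finite S" using finite_independent_subset_span[OF S(3) _ V(3)] S(2) V(2) by blast
  define E where "E = S - C"
  have CE: "C \<union> E = S" "C \<inter> E = {}" and fC: "finite C" and fE: "finite E"
    using S(1) fS finite_subset by (auto simp: E_def)
  have indE: "independent E" using S(3) independent_mono CE(1) by blast
  have spanE: "span E \<subseteq> V" using span_minimal[OF _ V(1)] S(2) CE(1) by blast
  have spanB: "span B = W" using span_subspace[OF B(1,3) W(1)] .
  have spanC: "span C = ?U" using span_subspace[OF C(1,3) U] .
  have spanS: "span S = V" using span_subspace[OF S(2,4) V(1)] .
  have "span C \<inter> span E \<subseteq> {0}" using span_Int_independent_Un[OF fC fE] S(3) CE by simp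
  then have zero: "v = 0" if "v \<in> span E" "T v \<in> W" for v
    using that spanC spanE by blast
  have inj: "inj_on T (span E)"
  proof (rule inj_onI)
    fix x y assume "x \<in> span E" "y \<in> span E" "T x = T y"
    then have "x - y = 0"
      using zero[of "x - y"] span_diff subspace_0[OF W(1)] by (simp add: T.diff)
    then show "x = y" by simp
  qed
  have indTE: "independent (T ` E)" by (rule T.independent_injective_image[OF indE inj])
  have "span B \<inter> span (T ` E) \<subseteq> {0}"
    unfolding spanB T.span_image using zero T.zero by blast
  from independent_Un[OF fB _ B(2) indTE this] fE
  have ind: "independent (B \<union> T ` E)" and disj: "B \<inter> T ` E = {}" by auto
  have image: "T v \<in> {w + T v | w v. w \<in> W \<and> v \<in> span E}" if v: "v \<in> V" for v
  proof -
    from v spanS CE(1) span_Un[of C E] obtain x y where "v = x + y" "x \<in> span C" "y \<in> span E" by auto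
    then show ?thesis using spanC by (auto simp: T.add)
  qed
  have "span (B \<union> T ` E) = {w + T v | w v. w \<in> W \<and> v \<in> span E}"
    unfolding span_Un spanB T.span_image by auto
  also have "\<dots> = {w + T v | w v. w \<in> W \<and> v \<in> V}"
  proof (intro equalityI subsetI)
    fix z assume "z \<in> {w + T v | w v. w \<in> W \<and> v \<in> V}"
    then obtain w v where z: "z = w + T v" "w \<in> W" "v \<in> V" by blast
    from image[OF z(3)] obtain w' v' where "T v = w' + T v'" "w' \<in> W" "v' \<in> span E" by blast
    then show "z \<in> {w + T v | w v. w \<in> W \<and> v \<in> span E}"
      using z subspace_add[OF W(1)] by (auto simp flip: add.assoc)
  qed (use spanE in blast)
  finally have "dim {w + T v | w v. w \<in> W \<and> v \<in> V} = card (B \<union> T ` E)"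
    using dim_span_eq_card_independent[OF ind] by simp
  also have "\<dots> = card B + card E"
    using card_Un_disjoint[OF fB _ disj] fE card_image[OF inj_on_subset[OF inj span_superset]] by simp
  finally have 1: "dim {w + T v | w v. w \<in> W \<and> v \<in> V} = card B + card E" .
  have "card S = card C + card E" using card_Un_disjoint[OF fC fE] CE by simp
  moreover have "dim ?U = card C" "dim W = card B" "dim V = card S"
    using dim_span_eq_card_independent spanB spanC spanS C(2) B(2) S(3) by metis+
  ultimately show ?thesis using 1 by simp
qed

end

section \<open>Homogeneous components\<close>

lemma monom_degree_add: "monom_degree (m + m') = monom_degree m + monom_degree m'"
  by (simp add: monom_degree_def lookup_add sum.distrib)

lemma monom_degree_zero [simp]: "monom_degree 0 = 0"
  by (simp add: monom_degree_def)

definition hom_comp :: "int \<Rightarrow> ('v::finite, 'k::zero) mpoly \<Rightarrow> ('v, 'k) mpoly" where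
  "hom_comp d p = Poly_Mapping.mapp (\<lambda>m c. if int (monom_degree m) = d then c else 0) p"

lemma lookup_hom_comp:
  "Poly_Mapping.lookup (hom_comp d p) m
     = (if int (monom_degree m) = d then Poly_Mapping.lookup p m else 0)"
  by (auto simp: hom_comp_def lookup_mapp when_def in_keys_iff)

lemma homogeneous_iff: "homogeneous d p \<longleftrightarrow> (\<forall>m. Poly_Mapping.lookup p m \<noteq> 0 \<longrightarrow> int (monom_degree m) = d)"
  by (auto simp: homogeneous_def in_keys_iff)

lemma homogeneous_hom_comp [simp]: "homogeneous d (hom_comp d p)"
  by (simp add: homogeneous_iff lookup_hom_comp)

lemma hom_comp_homogeneous:
  "homogeneous d p \<Longrightarrow> hom_comp e p = (if d = e then p else 0)"
  by (rule poly_mapping_eqI) (auto simp: homogeneous_iff lookup_hom_comp)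

lemma hom_comp_same: "homogeneous d p \<Longrightarrow> hom_comp d p = p"
  by (simp add: hom_comp_homogeneous)

lemma hom_comp_zero [simp]: "hom_comp d 0 = 0"
  by (rule poly_mapping_eqI) (simp add: lookup_hom_comp)

lemma hom_comp_add: "hom_comp d (p + q) = hom_comp d p + hom_comp d (q :: ('v::finite, 'k::comm_monoid_add) mpoly)"
  by (rule poly_mapping_eqI) (simp add: lookup_hom_comp lookup_add)

lemma hom_comp_diff: "hom_comp d (p - q) = hom_comp d p - hom_comp d (q :: ('v::finite, 'k::ab_group_add) mpoly)"
  by (rule poly_mapping_eqI) (simp add: lookup_hom_comp lookup_minus)

lemma hom_comp_sum:
  "hom_comp d (sum f A) = (\<Sum>x\<in>A. hom_comp d (f x :: ('v::finite, 'k::comm_monoid_add) mpoly))"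
  by (induction A rule: infinite_finite_induct) (auto simp: hom_comp_add)

lemma homogeneous_zero [simp]: "homogeneous d 0"
  by (simp add: homogeneous_iff)

lemma homogeneous_one [simp]: "homogeneous 0 (1 :: ('v::finite, 'k::zero_neq_one) mpoly)"
  by (simp add: homogeneous_def)

lemma homogeneous_uminus [simp]: "homogeneous d (- p) \<longleftrightarrow> homogeneous d (p :: ('v::finite, 'k::ab_group_add) mpoly)"
  by (simp add: homogeneous_iff)

lemma homogeneous_add:
  "homogeneous d p \<Longrightarrow> homogeneous d q \<Longrightarrow> homogeneous d (p + q :: ('v::finite, 'k::comm_monoid_add) mpoly)"
  unfolding homogeneous_iff lookup_add by (metis add.right_neutral)

lemma homogeneous_mult:
  fixes p q :: "('v::finite, 'k::comm_ring_1) mpoly"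
  assumes "homogeneous d p" "homogeneous e q"
  shows "homogeneous (d + e) (p * q)"
  unfolding homogeneous_def
proof
  fix m assume "m \<in> Poly_Mapping.keys (p * q)"
  with keys_mult[of p q] obtain a b
    where "m = a + b" "a \<in> Poly_Mapping.keys p" "b \<in> Poly_Mapping.keys q" by blast
  then show "int (monom_degree m) = d + e"
    using assms by (simp add: homogeneous_def monom_degree_add)
qed

text \<open>
  With \<open>q'\<close> the component of \<open>q\<close> of degree \<open>e - d\<close>, the
  remainder \<open>q - q'\<close> has no monomial of degree \<open>e - d\<close>, so its product
  with a form of degree \<open>d\<close> has none of degree \<open>e\<close>.
\<close>

lemma hom_comp_mult:
  fixes p q :: "('v::finite, 'k::comm_ring_1) mpoly"
  assumes "homogeneous d p"
  shows "hom_comp e (p * q) = p * hom_comp (e - d) q"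
proof -
  let ?q = "hom_comp (e - d) q"
  have "homogeneous e (p * ?q)"
    using homogeneous_mult[OF assms homogeneous_hom_comp, of "e - d" q] by simp
  then have 1: "hom_comp e (p * ?q) = p * ?q" by (simp add: hom_comp_homogeneous)
  have "int (monom_degree m) \<noteq> e" if m: "m \<in> Poly_Mapping.keys (p * (q - ?q))" for m
  proof -
    from m keys_mult[of p "q - ?q"] obtain a b
      where ab: "m = a + b" "a \<in> Poly_Mapping.keys p" "b \<in> Poly_Mapping.keys (q - ?q)" by blast
    have "int (monom_degree a) = d" using ab(2) assms by (simp add: homogeneous_def)
    moreover have "int (monom_degree b) \<noteq> e - d"
      using ab(3) unfolding in_keys_iff lookup_minus lookup_hom_comp by (metis diff_self)
    ultimately show ?thesis unfolding ab(1) monom_degree_add by simp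
  qed
  then have 2: "hom_comp e (p * (q - ?q)) = 0"
    unfolding in_keys_iff by (intro poly_mapping_eqI) (auto simp: lookup_hom_comp)
  have "p * q = p * ?q + p * (q - ?q)" by (simp add: algebra_simps)
  then show ?thesis using 1 2 by (simp add: hom_comp_add)
qed

lemma finite_monom_degree: "finite {m :: 'v::finite \<Rightarrow>\<^sub>0 nat. monom_degree m = d}"
proof -
  have le: "Poly_Mapping.lookup m v \<le> monom_degree m" for m :: "'v \<Rightarrow>\<^sub>0 nat" and v
    unfolding monom_degree_def by (rule member_le_sum) simp_all
  have "Poly_Mapping.lookup ` {m :: 'v \<Rightarrow>\<^sub>0 nat. monom_degree m = d} \<subseteq> Pi\<^sub>E UNIV (\<lambda>_. {..d})"
    using le by (intro image_subsetI) (simp add: PiE_UNIV_domain Pi_iff, metis)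
  moreover have "finite (Pi\<^sub>E (UNIV :: 'v set) (\<lambda>_. {..d}))"
    by (rule finite_PiE) simp_all
  ultimately have "finite (Poly_Mapping.lookup ` {m :: 'v \<Rightarrow>\<^sub>0 nat. monom_degree m = d})"
    by (rule finite_subset)
  then show ?thesis
    by (rule finite_imageD) (simp add: inj_on_def)
qed

section \<open>Ideals\<close>

text \<open>
  The rule \<open>a * (b * x) = (a * b) * x\<close> that every module contributes to the simplifier
  would loop with associativity when the module is the ring itself, hence its removal below.
\<close>

interpretation ideal: Modules.module "(*) :: 'a::comm_ring_1 \<Rightarrow> 'a \<Rightarrow> 'a"
  by standard (simp_all add: algebra_simps)

declare ideal.scale_scale [simp del]

lemma ideal_generated_by_snoc:
  "ideal_generated_by (set (fs @ [f])) = {j + f * g | j g. j \<in> ideal_generated_by (set fs)}"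
proof -
  have "set (fs @ [f]) = insert f (set fs)" by simp
  then have "ideal_generated_by (set (fs @ [f])) = {x. \<exists>k. x - k * f \<in> ideal_generated_by (set fs)}"
    using ideal.span_insert[of f "set fs"] by metis
  also have "\<dots> = {j + f * g | j g. j \<in> ideal_generated_by (set fs)}"
  proof (intro equalityI subsetI)
    fix x assume "x \<in> {x. \<exists>k. x - k * f \<in> ideal_generated_by (set fs)}"
    then obtain k where "x - k * f \<in> ideal_generated_by (set fs)" by blast
    moreover have "x = (x - k * f) + f * k" by (simp add: mult.commute)
    ultimately show "x \<in> {j + f * g | j g. j \<in> ideal_generated_by (set fs)}" by blast
  next
    fix x assume "x \<in> {j + f * g | j g. j \<in> ideal_generated_by (set fs)}"
    then obtain j g where x: "x = j + f * g" and j: "j \<in> ideal_generated_by (set fs)" by blast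
    have "x - g * f = j" by (simp add: x mult.commute)
    then show "x \<in> {x. \<exists>k. x - k * f \<in> ideal_generated_by (set fs)}" using j by blast
  qed
  finally show ?thesis .
qed

text \<open>
  Homogeneity of an ideal in the form in which it is used: it can be tested on components, which is
  what allows a relation modulo \<open>I\<close> to be replaced by its part of a given degree.
\<close>

definition graded_ideal :: "('v::finite, 'k::comm_ring_1) mpoly set \<Rightarrow> bool" where
  "graded_ideal I \<longleftrightarrow> is_ideal I \<and> (\<forall>p\<in>I. \<forall>d. hom_comp d p \<in> I)"

lemma graded_ideal_zero: "graded_ideal {0}"
  by (simp add: graded_ideal_def)

lemma graded_ideal_plus_multiples:
  fixes f :: "('v::finite, 'k::comm_ring_1) mpoly"
  assumes J: "graded_ideal J" and f: "homogeneous a f"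
  shows "graded_ideal {j + f * g | j g. j \<in> J}"
  unfolding graded_ideal_def
proof (intro conjI ballI allI)
  have J': "is_ideal J" using J by (simp add: graded_ideal_def)
  show "is_ideal {j + f * g | j g. j \<in> J}"
  proof (rule ideal.subspaceI)
    have "0 = 0 + f * 0" by simp
    then show "0 \<in> {j + f * g | j g. j \<in> J}" using ideal.subspace_0[OF J'] by blast
  next
    fix x y assume "x \<in> {j + f * g | j g. j \<in> J}" "y \<in> {j + f * g | j g. j \<in> J}"
    then obtain j g j' g' where xy: "x = j + f * g" "y = j' + f * g'" and j: "j \<in> J" "j' \<in> J" by blast
    have "x + y = (j + j') + f * (g + g')" unfolding xy by (simp add: algebra_simps)
    then show "x + y \<in> {j + f * g | j g. j \<in> J}" using ideal.subspace_add[OF J' j] by blast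
  next
    fix c x assume "x \<in> {j + f * g | j g. j \<in> J}"
    then obtain j g where x: "x = j + f * g" and j: "j \<in> J" by blast
    have "c * x = c * j + f * (c * g)" unfolding x by (simp add: algebra_simps)
    then show "c * x \<in> {j + f * g | j g. j \<in> J}" using ideal.subspace_scale[OF J' j] by blast
  qed
next
  fix p d assume "p \<in> {j + f * g | j g. j \<in> J}"
  then obtain j g where p: "p = j + f * g" and j: "j \<in> J" by blast
  have "hom_comp d p = hom_comp d j + f * hom_comp (d - a) g"
    unfolding p hom_comp_add hom_comp_mult[OF f] ..
  moreover have "hom_comp d j \<in> J" using J j by (simp add: graded_ideal_def)
  ultimately show "hom_comp d p \<in> {j + f * g | j g. j \<in> J}" by blast
qed

text \<open>
  Exponents are natural numbers, so no cancellation of degrees occurs; this is why the polynomials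
  without constant term form an ideal.
\<close>

lemma monom_degree_eq_zero: "monom_degree m = 0 \<Longrightarrow> m = 0"
  by (rule poly_mapping_eqI) (simp add: monom_degree_def)

lemma irrelevant_ideal_is_ideal: "is_ideal (irrelevant_ideal :: ('v::finite, 'k::comm_ring_1) mpoly set)"
proof (rule ideal.subspaceI)
  fix c x :: "('v, 'k) mpoly" assume x: "x \<in> irrelevant_ideal"
  have "monom_degree m \<noteq> 0" if m: "m \<in> Poly_Mapping.keys (c * x)" for m
  proof -
    from m keys_mult[of c x] obtain a b where ab: "m = a + b" "b \<in> Poly_Mapping.keys x" by blast
    have "b \<noteq> 0" using ab(2) x unfolding irrelevant_ideal_def in_keys_iff by blast
    then show ?thesis using monom_degree_eq_zero[of b] unfolding ab(1) monom_degree_add by linarith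
  qed
  then have "0 \<notin> Poly_Mapping.keys (c * x)" using monom_degree_zero by blast
  then show "c * x \<in> irrelevant_ideal" unfolding irrelevant_ideal_def in_keys_iff by blast
next
  show "0 \<in> (irrelevant_ideal :: ('v, 'k) mpoly set)" by (simp add: irrelevant_ideal_def)
next
  fix x y :: "('v, 'k) mpoly" assume "x \<in> irrelevant_ideal" "y \<in> irrelevant_ideal"
  then show "x + y \<in> irrelevant_ideal" by (simp add: irrelevant_ideal_def lookup_add)
qed

lemma one_notin_irrelevant_ideal: "(1 :: ('v::finite, 'k::zero_neq_one) mpoly) \<notin> irrelevant_ideal"
  by (simp add: irrelevant_ideal_def)

lemma homogeneous_in_irrelevant_ideal:
  "homogeneous d p \<Longrightarrow> d \<noteq> 0 \<Longrightarrow> p \<in> irrelevant_ideal"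
  unfolding homogeneous_iff irrelevant_ideal_def using monom_degree_zero
  by (metis (mono_tags, lifting) mem_Collect_eq of_nat_0)

section \<open>Hilbert series\<close>

interpretation mpoly: vector_space "\<lambda>(c :: 'k::field) (p :: ('v::finite, 'k) mpoly). Poly_Mapping.single 0 c * p"
  by standard (simp_all add: distrib_left distrib_right single_add mult_single flip: mult.assoc)

lemma homogeneous_subspace: "mpoly.subspace {p :: ('v::finite, 'k::field) mpoly. homogeneous d p}"
proof (rule mpoly.subspaceI)
  fix c :: 'k and p :: "('v, 'k) mpoly" assume p: "p \<in> {p. homogeneous d p}"
  have "homogeneous 0 (Poly_Mapping.single 0 c :: ('v, 'k) mpoly)" by (simp add: homogeneous_def)
  from homogeneous_mult[OF this, of d p] p
  show "Poly_Mapping.single 0 c * p \<in> {p. homogeneous d p}" by simp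
qed (simp_all add: homogeneous_add)

lemma ideal_homogeneous_subspace:
  fixes I :: "('v::finite, 'k::field) mpoly set"
  assumes "is_ideal I"
  shows "mpoly.subspace {p \<in> I. homogeneous d p}"
proof -
  have "mpoly.subspace I"
    using ideal.subspace_0[OF assms] ideal.subspace_add[OF assms] ideal.subspace_scale[OF assms]
    by (intro mpoly.subspaceI) blast+
  then have "mpoly.subspace (I \<inter> {p. homogeneous d p})"
    using homogeneous_subspace mpoly.subspace_inter by blast
  moreover have "I \<inter> {p. homogeneous d p} = {p \<in> I. homogeneous d p}" by blast
  ultimately show ?thesis by simp
qed

definition monomials :: "int \<Rightarrow> ('v::finite, 'k::field) mpoly set" where
  "monomials d = (\<lambda>m. Poly_Mapping.single m 1) ` {m. int (monom_degree m) = d}"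

lemma finite_monomials: "finite (monomials d)"
proof -
  have "finite {m :: 'v::finite \<Rightarrow>\<^sub>0 nat. int (monom_degree m) = d}"
    by (rule finite_subset[OF _ finite_monom_degree[of "nat d"]]) auto
  then show ?thesis unfolding monomials_def by (rule finite_imageI)
qed

lemma mpoly_eq_sum_monomials:
  fixes p :: "('v::finite, 'k::field) mpoly"
  shows "p = (\<Sum>m\<in>Poly_Mapping.keys p. Poly_Mapping.single 0 (Poly_Mapping.lookup p m) * Poly_Mapping.single m 1)"
  (is "p = ?s")
proof (rule poly_mapping_eqI)
  fix k
  have "Poly_Mapping.lookup ?s k
     = (\<Sum>m\<in>Poly_Mapping.keys p. if m = k then Poly_Mapping.lookup p m else 0)"
    by (simp add: lookup_sum mult_single lookup_single when_def)
  then show "Poly_Mapping.lookup p k = Poly_Mapping.lookup ?s k"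
    by (simp add: sum.delta in_keys_iff del: lookup_not_eq_zero_eq_in_keys)
qed

lemma homogeneous_span_monomials:
  "mpoly.span (monomials d) = {p :: ('v::finite, 'k::field) mpoly. homogeneous d p}"
proof (rule mpoly.span_subspace)
  show "monomials d \<subseteq> {p :: ('v, 'k) mpoly. homogeneous d p}"
    by (auto simp: monomials_def homogeneous_def)
  show "{p :: ('v, 'k) mpoly. homogeneous d p} \<subseteq> mpoly.span (monomials d)"
  proof
    fix p :: "('v, 'k) mpoly" assume p: "p \<in> {p. homogeneous d p}"
    have "Poly_Mapping.single m 1 \<in> (monomials d :: ('v, 'k) mpoly set)" if "m \<in> Poly_Mapping.keys p" for m
      using that p unfolding homogeneous_def monomials_def by blast
    then show "p \<in> mpoly.span (monomials d)"
      by (subst mpoly_eq_sum_monomials[of p]) (intro mpoly.span_sum mpoly.span_scale mpoly.span_base)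
  qed
qed (rule homogeneous_subspace)

lemma inj_monomial: "inj (\<lambda>m. Poly_Mapping.single m (1 :: 'k::field))"
  by (rule injI) (metis keys_single zero_neq_one singleton_inject)

lemma independent_monomials: "\<not> mpoly.dependent (monomials d :: ('v::finite, 'k::field) mpoly set)"
proof
  assume "mpoly.dependent (monomials d :: ('v, 'k) mpoly set)"
  then obtain u v where v: "v \<in> (monomials d :: ('v, 'k) mpoly set)" "u v \<noteq> 0"
    and s: "(\<Sum>p\<in>monomials d. Poly_Mapping.single 0 (u p) * p) = (0 :: ('v, 'k) mpoly)"
    unfolding mpoly.dependent_finite[OF finite_monomials] by blast
  obtain m where m: "v = Poly_Mapping.single m 1" using v(1) by (auto simp: monomials_def)
  have *: "Poly_Mapping.lookup (Poly_Mapping.single 0 (u p) * p) m = (if p = v then u p else 0)"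
    if p: "p \<in> monomials d" for p
  proof -
    obtain m' where m': "p = Poly_Mapping.single m' 1" using p by (auto simp: monomials_def)
    show ?thesis
      using inj_eq[OF inj_monomial, of m' m] unfolding m m'
      by (auto simp: mult_single lookup_single when_def)
  qed
  have "0 = Poly_Mapping.lookup (\<Sum>p\<in>monomials d. Poly_Mapping.single 0 (u p) * p) m"
    unfolding s by simp
  also have "\<dots> = (\<Sum>p\<in>monomials d. if p = v then u p else 0)"
    unfolding lookup_sum using * by (rule sum.cong[OF refl])
  also have "\<dots> = u v" using v(1) by (simp only: sum.delta[OF finite_monomials] if_True)
  finally show False using v(2) by simp
qed

lemma vdim_homogeneous:
  "vdim {p :: ('v::finite, 'k::field) mpoly. homogeneous d p} = card {m :: 'v \<Rightarrow>\<^sub>0 nat. int (monom_degree m) = d}"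
proof -
  have "vdim {p :: ('v, 'k) mpoly. homogeneous d p} = card (monomials d :: ('v, 'k) mpoly set)"
    unfolding vdim_def homogeneous_span_monomials[symmetric]
    by (rule mpoly.dim_span_eq_card_independent[OF independent_monomials])
  also have "\<dots> = card {m :: 'v \<Rightarrow>\<^sub>0 nat. int (monom_degree m) = d}"
    unfolding monomials_def by (rule card_image) (rule inj_on_subset[OF inj_monomial subset_UNIV])
  finally show ?thesis .
qed

text \<open>
  Exponent vectors correspond to lists of length \<open>CARD('v)\<close> along an enumeration of the
  variables, and lists with a prescribed sum are counted by stars and bars.
\<close>

lemma card_monom_degree:
  "card {m :: 'v::finite \<Rightarrow>\<^sub>0 nat. monom_degree m = d} = (CARD('v) + d - 1) choose d"
proof -
  obtain xs :: "'v list" where xs: "set xs = UNIV" "distinct xs"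
    using finite_distinct_list[of "UNIV :: 'v set"] by auto
  have len: "length xs = CARD('v)" using distinct_card[OF xs(2)] xs(1) by simp
  let ?L = "{l :: nat list. length l = CARD('v) \<and> sum_list l = d}"
  let ?g = "\<lambda>m :: 'v \<Rightarrow>\<^sub>0 nat. map (Poly_Mapping.lookup m) xs"
  have deg: "sum_list (?g m) = monom_degree m" for m
    using sum.distinct_set_conv_list[OF xs(2), of "Poly_Mapping.lookup m"] xs(1) by (simp add: monom_degree_def)
  have "bij_betw ?g {m. monom_degree m = d} ?L"
  proof (rule bij_betw_imageI)
    show "inj_on ?g {m. monom_degree m = d}"
    proof (rule inj_onI)
      fix m m' assume "?g m = ?g m'"
      then have "Poly_Mapping.lookup m v = Poly_Mapping.lookup m' v" for v
        using xs(1) by (metis map_eq_conv UNIV_I)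
      then show "m = m'" by (rule poly_mapping_eqI)
    qed
    show "?g ` {m. monom_degree m = d} = ?L"
    proof (intro equalityI subsetI)
      fix l assume "l \<in> ?g ` {m. monom_degree m = d}"
      then obtain m where "l = ?g m" "monom_degree m = d" by blast
      then show "l \<in> ?L" using deg[of m] len by simp
    next
      fix l assume l: "l \<in> ?L"
      define m where "m = Abs_poly_mapping (\<lambda>v. the (map_of (zip xs l) v))"
      have lookup: "Poly_Mapping.lookup m v = the (map_of (zip xs l) v)" for v
        unfolding m_def by (subst lookup_Abs_poly_mapping) simp_all
      have "?g m = l"
      proof (rule nth_equalityI)
        show "length (?g m) = length l" using len l by simp
        fix i assume "i < length (?g m)"
        then have "i < length xs" "length xs = length l" using len l by simp_all
        then show "?g m ! i = l ! i"
          using xs(2) map_of_zip_nth[of xs l i] by (simp add: lookup)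
      qed
      then show "l \<in> ?g ` {m. monom_degree m = d}" using deg[of m] l by (intro image_eqI[of _ _ m]) auto
    qed
  qed
  then have "card {m :: 'v \<Rightarrow>\<^sub>0 nat. monom_degree m = d} = card ?L" by (rule bij_betw_same_card)
  also have "\<dots> = (CARD('v) + d - 1) choose d"
    using card_length_sum_list[of "CARD('v)" d] by (simp add: add.commute)
  finally show ?thesis .
qed

text \<open>
  The Hilbert function of \<open>S/I\<close> extended to all integer degrees, so that twists need no
  case distinction.
\<close>

definition codimension :: "('v::finite, 'k::field) mpoly set \<Rightarrow> int \<Rightarrow> int" where
  "codimension I d = int (vdim {p :: ('v, 'k) mpoly. homogeneous d p}) - int (vdim {p \<in> I. homogeneous d p})"

lemma hilbert_function_eq_codimension: "int (hilbert_function I d) = codimension I (int d)"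
proof -
  have "vdim {p \<in> I. homogeneous (int d) p} \<le> card (monomials (int d) :: ('a, 'b) mpoly set)"
    unfolding vdim_def
    by (rule mpoly.dim_le_card[OF _ finite_monomials]) (auto simp: homogeneous_span_monomials)
  also have "\<dots> = vdim {p :: ('a, 'b) mpoly. homogeneous (int d) p}"
    unfolding vdim_def homogeneous_span_monomials[symmetric]
    by (rule mpoly.dim_span_eq_card_independent[OF independent_monomials, symmetric])
  finally show ?thesis by (simp add: hilbert_function_def codimension_def)
qed

lemma codimension_negative:
  assumes "d < 0" "is_ideal I"
  shows "codimension I d = 0"
proof -
  have zero: "p = 0" if "homogeneous d p" for p :: "('a, 'b) mpoly"
    using that assms(1) by (intro poly_mapping_eqI) (force simp: homogeneous_iff)
  have "{p \<in> I. homogeneous d p} = {p. homogeneous d p}"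
    using zero ideal.subspace_0[OF assms(2)] by auto
  then show ?thesis by (simp add: codimension_def)
qed

text \<open>
  Additivity of the Hilbert function along \<open>0 \<rightarrow> (S/J)(-a) \<rightarrow> S/J
  \<rightarrow> S/(J + fS) \<rightarrow> 0\<close>: the degree-\<open>d\<close> piece of \<open>J +
  fS\<close> is \<open>J\<^sub>d + f S\<^sub>d\<^sub>-\<^sub>a\<close>, and the forms of degree
  \<open>d - a\<close> that \<open>f\<close> maps into \<open>J\<close> are those of
  \<open>J\<close>.
\<close>

lemma codimension_plus_multiples:
  fixes f :: "('v::finite, 'k::field) mpoly"
  assumes J: "graded_ideal J" and f: "homogeneous a f"
    and regular: "\<And>g. f * g \<in> J \<Longrightarrow> g \<in> J"
  shows "codimension {j + f * g | j g. j \<in> J} d = codimension J d - codimension J (d - a)"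
proof -
  have J': "is_ideal J" using J by (simp add: graded_ideal_def)
  let ?W = "{p \<in> J. homogeneous d p}" and ?V = "{p :: ('v, 'k) mpoly. homogeneous (d - a) p}"
  have lin: "Vector_Spaces.linear (\<lambda>c p. Poly_Mapping.single 0 c * p) (\<lambda>c p. Poly_Mapping.single 0 c * p) (\<lambda>g. f * g)"
    unfolding Vector_Spaces.linear_iff using mpoly.vector_space_axioms
    by (simp add: distrib_left mult.left_commute)
  have hom: "homogeneous d (f * g)" if "homogeneous (d - a) g" for g
    using homogeneous_mult[OF f that] by simp
  have "{w + f * v | w v. w \<in> ?W \<and> v \<in> ?V} = {p \<in> {j + f * g | j g. j \<in> J}. homogeneous d p}"
  proof (intro equalityI subsetI)
    fix p assume "p \<in> {w + f * v | w v. w \<in> ?W \<and> v \<in> ?V}"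
    then show "p \<in> {p \<in> {j + f * g | j g. j \<in> J}. homogeneous d p}"
      using homogeneous_add hom by blast
  next
    fix p assume "p \<in> {p \<in> {j + f * g | j g. j \<in> J}. homogeneous d p}"
    then obtain j g where p: "p = j + f * g" "j \<in> J" "homogeneous d p" by blast
    have "p = hom_comp d p" using p(3) by (simp add: hom_comp_homogeneous)
    also have "\<dots> = hom_comp d j + f * hom_comp (d - a) g"
      unfolding p(1) hom_comp_add hom_comp_mult[OF f] ..
    finally have "p = hom_comp d j + f * hom_comp (d - a) g" .
    moreover have "hom_comp d j \<in> J" using J p(2) by (simp add: graded_ideal_def)
    moreover have "homogeneous d (hom_comp d j)" "homogeneous (d - a) (hom_comp (d - a) g)" by simp_all
    ultimately show "p \<in> {w + f * v | w v. w \<in> ?W \<and> v \<in> ?V}" by blast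
  qed
  moreover have "{v \<in> ?V. f * v \<in> ?W} = {p \<in> J. homogeneous (d - a) p}"
    using regular hom ideal.subspace_scale[OF J'] by blast
  moreover have "?W \<subseteq> mpoly.span (monomials d)" by (auto simp: homogeneous_span_monomials)
  ultimately have "vdim {p \<in> {j + f * g | j g. j \<in> J}. homogeneous d p} + vdim {p \<in> J. homogeneous (d - a) p}
      = vdim ?W + vdim ?V"
    using mpoly.dim_plus_image[OF lin ideal_homogeneous_subspace[OF J'] _ finite_monomials
        homogeneous_subspace _ finite_monomials, of d d "d - a" "d - a"]
    unfolding vdim_def homogeneous_span_monomials by simp
  then show ?thesis unfolding codimension_def by linarith
qed

definition hilbert_series :: "('v::finite, 'k::field) mpoly set \<Rightarrow> rat fps" where
  "hilbert_series I = Abs_fps (\<lambda>d. of_nat (hilbert_function I d))"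

lemma hilbert_series_nth: "fps_nth (hilbert_series I) d = of_int (codimension I (int d))"
  unfolding hilbert_series_def hilbert_function_eq_codimension[symmetric] by simp

lemma hilbert_series_zero_ideal:
  "hilbert_series {0 :: ('v::finite, 'k::field) mpoly} = inverse ((1 - fps_X) ^ CARD('v))"
proof (rule fps_ext)
  fix d
  have "{p \<in> {0 :: ('v, 'k) mpoly}. homogeneous (int d) p} = mpoly.span {}" by auto
  then have "vdim {p \<in> {0 :: ('v, 'k) mpoly}. homogeneous (int d) p} = 0"
    unfolding vdim_def using mpoly.dim_span_eq_card_independent[OF mpoly.independent_empty] by simp
  then have "fps_nth (hilbert_series {0 :: ('v, 'k) mpoly}) d = of_nat ((CARD('v) + d - 1) choose d)"
    unfolding hilbert_series_nth codimension_def vdim_homogeneous by (simp add: card_monom_degree)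
  then show "fps_nth (hilbert_series {0 :: ('v, 'k) mpoly}) d = fps_nth (inverse ((1 - fps_X) ^ CARD('v))) d"
    using one_minus_const_fps_X_neg_power'[of "CARD('v)" "1 :: rat"] by simp
qed

lemma hilbert_series_plus_multiples:
  fixes f :: "('v::finite, 'k::field) mpoly"
  assumes "graded_ideal J" and "homogeneous (int a) f" and "\<And>g. f * g \<in> J \<Longrightarrow> g \<in> J"
  shows "hilbert_series {j + f * g | j g. j \<in> J} = (1 - fps_X ^ a) * hilbert_series J"
proof (rule fps_ext)
  fix d
  have *: "codimension J (int d - int a) = (if d < a then 0 else codimension J (int (d - a)))"
    using codimension_negative[of "int d - int a" J] assms(1) by (simp add: graded_ideal_def of_nat_diff)
  then show "fps_nth (hilbert_series {j + f * g | j g. j \<in> J}) d = fps_nth ((1 - fps_X ^ a) * hilbert_series J) d"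
    using codimension_plus_multiples[OF assms(1,2) assms(3), of "int d"]
    unfolding hilbert_series_nth * left_diff_distrib fps_sub_nth fps_X_power_mult_nth mult_1
    by (cases "d < a") simp_all
qed

lemma regular_sequence_snoc:
  assumes "regular_sequence (fs @ [f])"
  shows "regular_sequence fs"
    and "f * g \<in> ideal_generated_by (set fs) \<Longrightarrow> g \<in> ideal_generated_by (set fs)"
proof -
  have reg: "(fs @ [f]) ! i * g \<in> ideal_generated_by (set (take i (fs @ [f]))) \<Longrightarrow> g \<in> ideal_generated_by (set (take i (fs @ [f])))"
    if "i < length (fs @ [f])" for i g
    using assms that unfolding regular_sequence_def by blast
  show "f * g \<in> ideal_generated_by (set fs) \<Longrightarrow> g \<in> ideal_generated_by (set fs)"
    using reg[of "length fs" g] by simp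
  have "1 \<notin> ideal_generated_by (set fs)"
    using assms ideal.span_mono[of "set fs" "set (fs @ [f])"] unfolding regular_sequence_def by auto
  moreover have "g \<in> ideal_generated_by (set (take i fs))"
    if "i < length fs" "fs ! i * g \<in> ideal_generated_by (set (take i fs))" for i g
    using reg[of i g] that by (simp add: nth_append)
  ultimately show "regular_sequence fs" unfolding regular_sequence_def by blast
qed

lemma graded_ideal_generated_by:
  fixes fs :: "('v::finite, 'k::comm_ring_1) mpoly list"
  assumes "\<And>f. f \<in> set fs \<Longrightarrow> \<exists>a. homogeneous a f"
  shows "graded_ideal (ideal_generated_by (set fs))"
  using assms
proof (induction fs rule: rev_induct)
  case Nil
  then show ?case by (simp add: graded_ideal_zero)
next
  case (snoc f fs)
  then obtain a where "homogeneous a f" by auto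
  with snoc show ?case unfolding ideal_generated_by_snoc by (intro graded_ideal_plus_multiples) auto
qed

lemma hilbert_series_regular_sequence:
  fixes fs :: "('v::finite, 'k::field) mpoly list"
  assumes "list_all2 (\<lambda>a f. homogeneous (int a) f) as fs" "regular_sequence fs"
  shows "hilbert_series (ideal_generated_by (set fs))
     = (\<Prod>a\<in>#mset as. 1 - fps_X ^ a) * inverse ((1 - fps_X) ^ CARD('v))"
  using assms
proof (induction fs arbitrary: as rule: rev_induct)
  case Nil
  then show ?case by (simp add: hilbert_series_zero_ideal)
next
  case (snoc f fs)
  then obtain as' a where as: "as = as' @ [a]" "list_all2 (\<lambda>a f. homogeneous (int a) f) as' fs" "homogeneous (int a) f"
    by (auto simp: list_all2_append2 list_all2_Cons2)
  have "graded_ideal (ideal_generated_by (set fs))"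
    using as(2) by (intro graded_ideal_generated_by) (auto simp: list_all2_conv_all_nth in_set_conv_nth)
  from hilbert_series_plus_multiples[OF this as(3) regular_sequence_snoc(2)[OF snoc.prems(2)]]
  show ?case
    unfolding ideal_generated_by_snoc snoc.IH[OF as(2) regular_sequence_snoc(1)[OF snoc.prems(2)]] as(1)
    by (simp add: mult.assoc)
qed

section \<open>Products of the polynomials \<open>1 - x\<^sup>a\<close>\<close>

text \<open>
  The variable of the polynomial ring as an opaque constant; written as \<open>[:0, 1:]\<close>, its
  powers and sums would be normalized to coefficient lists by the simplifier.
\<close>

definition indet :: "rat poly" where "indet = [:0, 1:]"

lemma poly_indet [simp]: "poly indet x = x"
  by (simp add: indet_def)

lemma indet_power: "indet ^ k = monom 1 k"
  by (simp add: indet_def monom_altdef)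

lemma coeff_indet_power_mult: "coeff (indet ^ k * p) n = (if n < k then 0 else coeff p (n - k))"
  by (simp add: indet_power coeff_monom_mult)

lemma coeff_indet_power: "coeff (indet ^ k) n = (if n = k then 1 else 0)"
  by (simp add: indet_power)

lemma degree_one_minus_indet_power:
  assumes "a > 0"
  shows "degree (1 - indet ^ a) = a"
proof (rule antisym)
  show "degree (1 - indet ^ a) \<le> a" by (rule degree_diff_le) (simp_all add: indet_power degree_monom_le)
  have "coeff (1 - indet ^ a) a = - 1"
    using assms unfolding coeff_diff coeff_indet_power coeff_1 by (cases a) simp_all
  then have "coeff (1 - indet ^ a) a \<noteq> 0" by (metis neg_equal_0_iff_equal zero_neq_one)
  then show "a \<le> degree (1 - indet ^ a)" by (rule le_degree)
qed

lemma one_minus_indet_power_nonzero: "a > 0 \<Longrightarrow> 1 - indet ^ a \<noteq> 0"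
  by (metis degree_0 degree_one_minus_indet_power less_irrefl)

lemma one_minus_indet_nonzero: "1 - indet \<noteq> 0"
  using one_minus_indet_power_nonzero[of 1] by simp

lemma pderiv_indet [simp]: "pderiv indet = 1"
  by (simp add: indet_def pderiv_pCons)

text \<open>
  The numerator \<open>N\<close> of the Hilbert series of a complete intersection with degrees
  \<open>A\<close>.
\<close>

definition ci_numerator :: "nat multiset \<Rightarrow> rat poly" where
  "ci_numerator A = (\<Prod>a\<in>#A. 1 - indet ^ a)"

definition geometric_sum :: "nat \<Rightarrow> rat poly" where
  "geometric_sum a = (\<Sum>i<a. indet ^ i)"

text \<open>
  The numerator after cancelling all factors \<open>1 - t\<close>; its value and derivative at
  \<open>1\<close> recover the product and the sum of the degrees.
\<close>

definition reduced_numerator :: "nat multiset \<Rightarrow> rat poly" where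
  "reduced_numerator A = (\<Prod>a\<in>#A. geometric_sum a)"

lemma ci_numerator_factor: "ci_numerator A = (1 - indet) ^ size A * reduced_numerator A"
proof (induction A)
  case (add a A)
  have "1 - indet ^ a = (1 - indet) * geometric_sum a"
    unfolding geometric_sum_def by (rule one_diff_power_eq)
  then show ?case
    using add by (simp add: ci_numerator_def reduced_numerator_def mult_ac)
qed (simp add: ci_numerator_def reduced_numerator_def)

lemma poly_reduced_numerator_1: "poly (reduced_numerator A) 1 = of_nat (prod_mset A)"
  by (induction A) (simp_all add: reduced_numerator_def geometric_sum_def poly_sum)

lemma poly_pderiv_geometric_sum_1: "poly (pderiv (geometric_sum a)) 1 = of_nat a * (of_nat a - 1) / 2"
proof (induction a)
  case (Suc a)
  have "poly (pderiv (indet ^ a)) 1 = of_nat a"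
    by (simp add: pderiv_power)
  then have "poly (pderiv (geometric_sum (Suc a))) 1 = poly (pderiv (geometric_sum a)) 1 + of_nat a"
    by (simp add: geometric_sum_def pderiv_add)
  then show ?case using Suc by (simp add: field_simps)
qed (simp add: geometric_sum_def)

lemma poly_pderiv_reduced_numerator_1:
  "poly (pderiv (reduced_numerator A)) 1 = of_nat (prod_mset A) * (of_nat (sum_mset A) - of_nat (size A)) / 2"
proof (induction A)
  case (add a A)
  define p s n where "p = rat_of_nat (prod_mset A)" and "s = rat_of_nat (sum_mset A)" and "n = rat_of_nat (size A)"
  have mult: "reduced_numerator (add_mset a A) = geometric_sum a * reduced_numerator A"
    by (simp add: reduced_numerator_def)
  have one: "poly (geometric_sum a) 1 = of_nat a"
    by (simp add: geometric_sum_def poly_sum)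
  have "poly (pderiv (reduced_numerator (add_mset a A))) 1
      = of_nat a * (p * (s - n) / 2) + p * (of_nat a * (of_nat a - 1) / 2)"
    unfolding mult pderiv_mult poly_add poly_mult one poly_reduced_numerator_1 add
      poly_pderiv_geometric_sum_1 p_def s_def n_def ..
  also have "\<dots> = (of_nat a * p) * ((of_nat a + s) - (n + 1)) / 2"
    by (simp add: field_simps)
  also have "\<dots> = of_nat (prod_mset (add_mset a A)) * (of_nat (sum_mset (add_mset a A)) - of_nat (size (add_mset a A))) / 2"
    by (simp add: p_def s_def n_def)
  finally show ?case .
qed (simp add: reduced_numerator_def)

lemma degree_ci_numerator: "degree (ci_numerator A) \<le> sum_mset A"
proof (induction A)
  case (add a A)
  have "degree (1 - indet ^ a) \<le> a"
    by (rule degree_diff_le) (simp_all add: indet_power degree_monom_le)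
  then show ?case
    using add degree_mult_le[of "1 - indet ^ a" "ci_numerator A"] by (simp add: ci_numerator_def)
qed (simp add: ci_numerator_def)

text \<open>
  Modulo \<open>t\<^sup>m\<^sup>+\<^sup>1\<close> only the factors \<open>1 - t\<^sup>m\<close> are
  visible, and products of the terms \<open>t\<^sup>m\<close> vanish because \<open>2m > m\<close>.
\<close>

lemma ci_numerator_low_order:
  assumes "m > 0" "\<forall>a\<in>#A. m \<le> a"
  shows "\<exists>R. ci_numerator A = 1 - of_nat (count A m) * indet ^ m + indet ^ Suc m * R"
  using assms(2)
proof (induction A)
  case empty
  then show ?case by (intro exI[of _ 0]) (simp add: ci_numerator_def)
next
  case (add a A)
  then obtain R where R: "ci_numerator A = 1 - of_nat (count A m) * indet ^ m + indet ^ Suc m * R" by auto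
  have step: "ci_numerator (add_mset b A) = (1 - indet ^ b) * ci_numerator A" for b
    by (simp add: ci_numerator_def)
  let ?k = "of_nat (count A m) :: rat poly" and ?y = "indet ^ m" and ?z = "indet ^ Suc m"
  show ?case
  proof (cases "a = m")
    case True
    have expand: "(1 - y) * (1 - k * y + z * r) = 1 - (k + 1) * y + z * (k * w + (1 - y) * r)"
      if "y * y = z * w" for y z w k r :: "rat poly"
      using arg_cong[OF that, of "\<lambda>t. k * t"] by (simp add: algebra_simps)
    have "?y * ?y = ?z * indet ^ (m - 1)" using assms(1) by (simp flip: power_add power_Suc)
    from expand[OF this]
    have "ci_numerator (add_mset m A) = 1 - (?k + 1) * ?y + ?z * (?k * indet ^ (m - 1) + (1 - ?y) * R)"
      unfolding step R .
    moreover have "of_nat (count (add_mset a A) m) = ?k + 1" using True by simp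
    ultimately show ?thesis unfolding True by metis
  next
    case False
    let ?w = "indet ^ (a - Suc m)"
    have w: "indet ^ a = ?z * ?w" using add.prems False by (simp flip: power_add power_Suc)
    have "?z * R = ci_numerator A - (1 - ?k * ?y)" unfolding R by simp
    then have "ci_numerator (add_mset a A) = 1 - ?k * ?y + ?z * (R - ?w * ci_numerator A)"
      unfolding step w right_diff_distrib left_diff_distrib by (simp add: mult.assoc)
    moreover have "count (add_mset a A) m = count A m" using False by simp
    ultimately show ?thesis by metis
  qed
qed

text \<open>
  The coefficient at the smallest exponent \<open>m\<close> of either product shows that
  \<open>m\<close> has the same multiplicity in both; one factor \<open>1 - t\<^sup>m\<close> can
  then be cancelled.
\<close>

lemma ci_numerator_inject:
  assumes "\<forall>a\<in>#A. 0 < a" "\<forall>b\<in>#B. 0 < b" "ci_numerator A = ci_numerator B"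
  shows "A = B"
  using assms
proof (induction "size A + size B" arbitrary: A B rule: less_induct)
  case less
  show ?case
  proof (cases "A + B = {#}")
    case False
    define m where "m = Min (set_mset (A + B))"
    have "m \<in> set_mset (A + B)" unfolding m_def using False by (intro Min_in) auto
    then have m: "m \<in># A \<or> m \<in># B" by simp
    have pos: "m > 0" using m less.prems(1,2) by blast
    have le: "m \<le> a" if "a \<in># A + B" for a unfolding m_def using that by (intro Min_le) auto
    have leA: "\<forall>a\<in>#A. m \<le> a" and leB: "\<forall>a\<in>#B. m \<le> a" using le by auto
    obtain R S where R: "ci_numerator A = 1 - of_nat (count A m) * indet ^ m + indet ^ Suc m * R"
      and S: "ci_numerator B = 1 - of_nat (count B m) * indet ^ m + indet ^ Suc m * S"
      using ci_numerator_low_order[OF pos leA] ci_numerator_low_order[OF pos leB] by blast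
    have coeff: "coeff (1 - of_nat k * indet ^ m + indet ^ Suc m * R) m = - of_nat k" for k and R :: "rat poly"
      using pos by (simp add: of_nat_poly coeff_indet_power coeff_indet_power_mult del: power_Suc)
    have "count A m = count B m"
      using coeff[of "count A m" R] coeff[of "count B m" S] less.prems(3)
      unfolding R[symmetric] S[symmetric] by simp
    then have mAB: "m \<in># A" "m \<in># B" using m by (auto simp flip: count_greater_zero_iff)
    then obtain A' B' where AB: "A = add_mset m A'" "B = add_mset m B'" by (meson mset_add)
    have "(1 - indet ^ m) * ci_numerator A' = (1 - indet ^ m) * ci_numerator B'"
      using less.prems(3) unfolding AB by (simp add: ci_numerator_def)
    then have "ci_numerator A' = ci_numerator B'" using one_minus_indet_power_nonzero[OF pos] by simp
    then have "A' = B'" using less.prems(1,2) unfolding AB by (intro less.hyps) (auto simp: AB)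
    then show ?thesis by (simp add: AB)
  qed simp
qed

text \<open>
  The order of vanishing of the numerator at \<open>1\<close> is the number of factors.
\<close>

lemma size_le_if_numerators_congruent:
  assumes "0 \<notin># A" "size A \<le> n" and dvd: "(1 - indet) ^ Suc n dvd ci_numerator A - ci_numerator B"
  shows "size B \<le> size A"
proof (rule ccontr)
  assume "\<not> size B \<le> size A"
  then have "(1 - indet) ^ Suc (size A) dvd (1 - indet) ^ size B" by (intro le_imp_power_dvd) simp
  then have "(1 - indet) ^ Suc (size A) dvd ci_numerator B" unfolding ci_numerator_factor by (rule dvd_mult2)
  moreover have "(1 - indet) ^ Suc (size A) dvd ci_numerator A - ci_numerator B"
    using assms(2) by (intro dvd_trans[OF le_imp_power_dvd dvd]) simp
  ultimately have "(1 - indet) ^ Suc (size A) dvd ci_numerator A" by (metis diff_add_cancel dvd_add)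
  then have "(1 - indet) ^ size A * (1 - indet) dvd (1 - indet) ^ size A * reduced_numerator A"
    unfolding ci_numerator_factor power_Suc2 .
  moreover have "(1 - indet) ^ size A \<noteq> 0" using one_minus_indet_nonzero by simp
  ultimately have "1 - indet dvd reduced_numerator A" using dvd_mult_cancel_left by blast
  then have "poly (reduced_numerator A) 1 = 0" by (auto elim!: dvdE)
  then show False using assms(1) by (simp add: poly_reduced_numerator_1)
qed

text \<open>
  The arithmetic core of the reconstruction. The bound on the sum of \<open>A\<close> makes the
  degree of its numerator smaller than \<open>n + 1\<close>; the same bound for \<open>B\<close> has
  to be derived, by showing that the sums agree.
\<close>

lemma degrees_determined:
  assumes A: "\<forall>a\<in>#A. 0 < a" "size A \<le> n" "sum_mset A \<le> n"
    and B: "\<forall>b\<in>#B. 0 < b" "size B \<le> n"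
    and dvd: "(1 - indet) ^ Suc n dvd ci_numerator A - ci_numerator B"
  shows "A = B"
proof -
  have "(1 - indet) ^ Suc n dvd ci_numerator B - ci_numerator A"
    using dvd by (simp add: dvd_diff_commute)
  then have size: "size B = size A"
    using size_le_if_numerators_congruent[OF _ A(2) dvd] size_le_if_numerators_congruent[OF _ B(2)] A(1) B(1)
    by (metis le_antisym less_irrefl)
  define c where "c = size A"
  obtain R where R: "ci_numerator A - ci_numerator B = (1 - indet) ^ Suc n * R" using dvd by blast
  have "(1 - indet) ^ c * (reduced_numerator A - reduced_numerator B) = (1 - indet) ^ c * ((1 - indet) ^ (Suc n - c) * R)"
    using R A(2) size unfolding ci_numerator_factor c_def
    by (simp add: right_diff_distrib flip: mult.assoc power_add)
  moreover have "(1 - indet) ^ c \<noteq> 0" using one_minus_indet_nonzero by simp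
  ultimately have "reduced_numerator A - reduced_numerator B = (1 - indet) ^ (Suc n - c) * R"
    using mult_left_cancel by blast
  then have red: "reduced_numerator A = reduced_numerator B + (1 - indet) ^ (Suc n - c) * R"
    by (simp add: algebra_simps)
  have "poly (reduced_numerator A) 1 = poly (reduced_numerator B) 1"
    unfolding red using A(2) by (simp add: c_def)
  then have prod: "prod_mset A = prod_mset B" by (simp add: poly_reduced_numerator_1)
  have sum: "sum_mset B = sum_mset A"
  proof (cases "c = n")
    case True
    (* Here the derivative gives nothing, but the sum of A is at most n, the number of its elements. *)
    have ge: "size M \<le> sum_mset M" if "\<forall>a\<in>#M. 0 < a" for M :: "nat multiset"
      using that by (induction M) auto
    have ones: "\<forall>a\<in>#M. a = 1" if "\<forall>a\<in>#M. 0 < a" "sum_mset M \<le> size M" for M :: "nat multiset"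
    proof
      fix a assume "a \<in># M"
      then obtain N where N: "M = add_mset a N" by (meson mset_add)
      then show "a = 1" using that ge[of N] by (simp add: N)
    qed
    have "prod_mset A = 1" using ones[of A] A True by (intro prod_mset.neutral) (simp add: c_def)
    then have "\<forall>b\<in>#B. b = 1" using prod by (metis nat_dvd_1_iff_1 dvd_prod_mset)
    then have "sum_mset B = size B" by (induction B) auto
    then show ?thesis using ge[OF A(1)] A(3) size True by (simp add: c_def)
  next
    case False
    then obtain k where k: "Suc n - c = Suc (Suc k)"
      using A(2) by (metis Suc_diff_le c_def diff_is_0_eq le_antisym not0_implies_Suc)
    have "poly (pderiv (reduced_numerator A)) 1 = poly (pderiv (reduced_numerator B)) 1"
      unfolding red k by (simp add: pderiv_add pderiv_mult pderiv_power_Suc)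
    moreover have "prod_mset A \<noteq> 0" using A(1) by auto
    moreover have "x = y" if "p * (x - z) / 2 = p * (y - z) / 2" "p \<noteq> 0" for p x y z :: rat
      using that by simp
    ultimately have "rat_of_nat (sum_mset A) = of_nat (sum_mset B)"
      unfolding poly_pderiv_reduced_numerator_1 size prod[symmetric] of_nat_eq_0_iff[symmetric, where 'a = rat]
      by blast
    then show ?thesis by (simp only: of_nat_eq_iff)
  qed
  have "ci_numerator A - ci_numerator B = 0"
  proof (rule ccontr)
    assume nz: "ci_numerator A - ci_numerator B \<noteq> 0"
    have "degree (ci_numerator A - ci_numerator B) \<le> n"
      using A(3) sum degree_ci_numerator[of A] degree_ci_numerator[of B] by (intro degree_diff_le) auto
    moreover have "degree ((1 - indet) ^ Suc n) = Suc n"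
      using degree_power_eq[OF one_minus_indet_nonzero, of "Suc n"] degree_one_minus_indet_power[of 1]
      by (simp del: power_Suc)
    ultimately show False using dvd_imp_degree_le[OF dvd nz] by simp
  qed
  then show ?thesis using A(1) B(1) by (intro ci_numerator_inject) auto
qed

lemma fps_of_poly_indet: "fps_of_poly indet = fps_X"
  by (simp add: indet_def fps_of_poly_fps_X)

section \<open>Hilbert polynomials\<close>

text \<open>
  The coefficients of \<open>(1 - t)\<^sup>-\<^sup>m\<close> are the binomial coefficients \<open>(m
  - 1 + d) choose (m - 1)\<close>, polynomial in \<open>d\<close>; multiplying by \<open>t\<close>
  shifts the argument by one, at the cost of one more exceptional degree.
\<close>

lemma eventually_polynomial:
  assumes "m > 0"
  shows "\<exists>P :: rat poly. \<exists>d0. \<forall>d\<ge>d0. poly P (of_nat d) = fps_nth (fps_of_poly N * inverse ((1 - fps_X) ^ m)) d"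
proof (induction N)
  case 0
  then show ?case by (intro exI[of _ 0]) simp
next
  case (pCons c N)
  let ?G = "inverse ((1 - fps_X) ^ m) :: rat fps"
  let ?p = "Polynomial.smult (1 / fact (m - 1)) (\<Prod>i = 0..<m - 1. [:of_nat (m - 1) - of_nat i, 1 :: rat:])"
  have "\<exists>B :: rat poly. \<forall>d. poly B (of_nat d) = fps_nth ?G d"
  proof (intro exI allI)
    fix d
    show "poly ?p (of_nat d) = fps_nth ?G d"
    proof -
      have "fps_nth ?G d = of_nat ((m + d - 1) choose d)"
        using one_minus_const_fps_X_neg_power'[OF assms, of "1 :: rat"] by simp
      also have "(m + d - 1) choose d = (m + d - 1) choose (m - 1)"
        using assms by (subst binomial_symmetric) auto
      also have "of_nat \<dots> = (of_nat (m + d - 1) :: rat) gchoose (m - 1)"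
        by (rule binomial_gbinomial)
      also have "\<dots> = poly ?p (of_nat d)"
        using assms by (simp add: gbinomial_prod_rev poly_prod of_nat_diff algebra_simps)
      finally show ?thesis by simp
    qed
  qed
  then obtain B :: "rat poly" where B: "\<And>d. poly B (of_nat d) = fps_nth ?G d" by blast
  from pCons obtain P d0 where P: "\<And>d. d \<ge> d0 \<Longrightarrow> poly P (of_nat d) = fps_nth (fps_of_poly N * ?G) d" by blast
  have "poly (Polynomial.smult c B + pcompose P [:-1, 1:]) (of_nat d) = fps_nth (fps_of_poly (pCons c N) * ?G) d"
    if d: "d \<ge> Suc d0" for d
  proof -
    have "fps_of_poly (pCons c N) * ?G = fps_const c * ?G + fps_X * (fps_of_poly N * ?G)"
      by (simp add: fps_of_poly_pCons algebra_simps)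
    then have "fps_nth (fps_of_poly (pCons c N) * ?G) d = c * fps_nth ?G d + fps_nth (fps_of_poly N * ?G) (d - 1)"
      using d by simp
    moreover have "poly (pcompose P [:-1, 1:]) (of_nat d) = poly P (of_nat (d - 1))"
      using d by (simp add: poly_pcompose of_nat_diff)
    ultimately show ?thesis using P[of "d - 1"] d B[of d] by simp
  qed
  then show ?case by blast
qed

lemma poly_eq_if_eventually_eq:
  fixes P Q :: "rat poly"
  assumes "\<forall>d\<ge>d0. poly P (of_nat d) = poly Q (of_nat d)"
  shows "P = Q"
proof (rule ccontr)
  assume "P \<noteq> Q"
  then have "finite {x. poly (P - Q) x = 0}" by (intro poly_roots_finite) simp
  moreover have "of_nat ` {d0..} \<subseteq> {x. poly (P - Q) x = 0}" using assms by auto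
  ultimately have "finite (of_nat ` {d0..} :: rat set)" using finite_subset by blast
  then have "finite {d0..}" by (rule finite_imageD) (simp add: inj_on_def)
  then show False by (simp add: infinite_Ici)
qed

text \<open>
  The Hilbert polynomial is a definite description, so it carries information only once existence
  and uniqueness are known.
\<close>

lemma hilbert_polynomial_eventually:
  assumes "hilbert_series I = fps_of_poly N * inverse ((1 - fps_X) ^ m)" "m > 0"
  shows "\<exists>d0. \<forall>d\<ge>d0. poly (hilbert_polynomial I) (of_nat d) = fps_nth (hilbert_series I) d"
proof -
  let ?Q = "\<lambda>P. \<exists>d0. \<forall>d\<ge>d0. poly P (of_nat d) = (of_nat (hilbert_function I d) :: rat)"
  obtain P d0 where "\<forall>d\<ge>d0. poly P (of_nat d) = fps_nth (hilbert_series I) d"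
    using eventually_polynomial[OF assms(2), of N] unfolding assms(1)[symmetric] by blast
  then have P: "?Q P" unfolding hilbert_series_def fps_nth_Abs_fps by blast
  moreover have "P' = P" if P': "?Q P'" for P'
  proof -
    from P P' obtain d0 d1 where "\<forall>d\<ge>d0. poly P' (of_nat d) = (of_nat (hilbert_function I d) :: rat)"
      "\<forall>d\<ge>d1. poly P (of_nat d) = (of_nat (hilbert_function I d) :: rat)" by blast
    then show ?thesis by (intro poly_eq_if_eventually_eq[of "max d0 d1"]) simp
  qed
  ultimately have "?Q (hilbert_polynomial I)" unfolding hilbert_polynomial_def by (rule theI)
  then show ?thesis by (simp add: hilbert_series_def)
qed

lemma fps_of_poly_if_eventually_zero:
  assumes "\<forall>d\<ge>d0. fps_nth F d = 0"
  shows "\<exists>D. F = fps_of_poly D"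
proof
  show "F = fps_of_poly (Poly (map (fps_nth F) [0..<d0]))"
    by (rule fps_ext) (use assms in \<open>auto simp: coeff_Poly_eq nth_default_def\<close>)
qed

lemma same_hilbert_polynomial_imp_dvd:
  assumes X: "hilbert_series I = fps_of_poly M * inverse ((1 - fps_X) ^ m)"
    and Y: "hilbert_series J = fps_of_poly N * inverse ((1 - fps_X) ^ m)"
    and "m > 0" "hilbert_polynomial I = hilbert_polynomial J"
  shows "(1 - indet) ^ m dvd M - N"
proof -
  obtain d0 d1 where d0: "\<forall>d\<ge>d0. poly (hilbert_polynomial I) (of_nat d) = fps_nth (hilbert_series I) d"
    and d1: "\<forall>d\<ge>d1. poly (hilbert_polynomial I) (of_nat d) = fps_nth (hilbert_series J) d"
    using hilbert_polynomial_eventually[OF X \<open>m > 0\<close>] hilbert_polynomial_eventually[OF Y \<open>m > 0\<close>] assms(4)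
    by metis
  have "\<forall>d\<ge>max d0 d1. fps_nth (hilbert_series I - hilbert_series J) d = 0"
    by (simp add: fps_sub_nth flip: d0[rule_format] d1[rule_format])
  then obtain D where D: "hilbert_series I - hilbert_series J = fps_of_poly D"
    using fps_of_poly_if_eventually_zero by blast
  let ?u = "(1 - fps_X) ^ m :: rat fps"
  have u: "inverse ?u * ?u = 1" by (rule inverse_mult_eq_1) (simp add: fps_power_zeroth)
  have "fps_of_poly (M - N) = (hilbert_series I - hilbert_series J) * ?u"
    unfolding X Y using u by (simp add: fps_of_poly_diff left_diff_distrib mult.assoc)
  also have "\<dots> = fps_of_poly (D * (1 - indet) ^ m)"
    unfolding D by (simp add: fps_of_poly_mult fps_of_poly_power fps_of_poly_diff fps_of_poly_indet)
  finally have "M - N = D * (1 - indet) ^ m" by (simp only: fps_of_poly_eq_iff)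
  then show ?thesis by simp
qed

lemma fps_of_poly_ci_numerator: "fps_of_poly (ci_numerator A) = (\<Prod>a\<in>#A. 1 - fps_X ^ a)"
  by (induction A)
     (simp_all add: ci_numerator_def fps_of_poly_mult fps_of_poly_power fps_of_poly_diff fps_of_poly_indet)

section \<open>Matrices over a commutative ring\<close>

lemma mult_mat_vec_smult:
  fixes A :: "'a::comm_ring_1 mat"
  assumes "A \<in> carrier_mat n m" "v \<in> carrier_vec m"
  shows "A *\<^sub>v (k \<cdot>\<^sub>v v) = k \<cdot>\<^sub>v (A *\<^sub>v v)"
  using assms by (intro eq_vecI) (auto simp: scalar_prod_smult_distrib[of _ m])

lemma smult_mat_mult_vec:
  fixes A :: "'a::comm_ring_1 mat"
  assumes "A \<in> carrier_mat n m" "v \<in> carrier_vec m"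
  shows "(k \<cdot>\<^sub>m A) *\<^sub>v v = k \<cdot>\<^sub>v (A *\<^sub>v v)"
  using assms by (intro eq_vecI) (auto simp: row_smult smult_scalar_prod_distrib[of _ m])

lemma mult_mat_unit_vec:
  fixes A :: "'a::comm_ring_1 mat"
  assumes "A \<in> carrier_mat n m" "q < m"
  shows "A *\<^sub>v unit_vec m q = col A q"
  using assms by (intro eq_vecI) (auto simp: scalar_prod_right_unit[of _ m])

lemma zero_mat_mult_vec:
  "v \<in> carrier_vec m \<Longrightarrow> 0\<^sub>m n m *\<^sub>v v = (0\<^sub>v n :: 'a::comm_ring_1 vec)"
  by (intro eq_vecI) (auto simp: scalar_prod_def)

lemma eq_mat_if_mult_vec_eq:
  fixes A :: "'a::comm_ring_1 mat"
  assumes A: "A \<in> carrier_mat n m" and B: "B \<in> carrier_mat n m"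
    and eq: "\<And>v. v \<in> carrier_vec m \<Longrightarrow> A *\<^sub>v v = B *\<^sub>v v"
  shows "A = B"
proof (rule mat_col_eqI)
  fix q assume "q < dim_col B"
  then have q: "q < m" using B by simp
  show "col A q = col B q"
    using eq[OF unit_vec_carrier, of q] unfolding mult_mat_unit_vec[OF A q] mult_mat_unit_vec[OF B q] .
qed (use A B in auto)

text \<open>
  Maps out of a free module lift through any map whose image contains theirs: choose preimages of
  the columns.
\<close>

lemma factor_matrix:
  fixes A :: "'a::comm_ring_1 mat"
  assumes A: "A \<in> carrier_mat n m" and B: "B \<in> carrier_mat n r"
    and image: "\<And>v. v \<in> carrier_vec m \<Longrightarrow> \<exists>w\<in>carrier_vec r. A *\<^sub>v v = B *\<^sub>v w"
  shows "\<exists>C\<in>carrier_mat r m. A = B * C"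
proof -
  have "\<exists>w. w \<in> carrier_vec r \<and> col A q = B *\<^sub>v w" if "q < m" for q
    using image[OF unit_vec_carrier, of q] unfolding mult_mat_unit_vec[OF A that] by blast
  then obtain w where w: "\<And>q. q < m \<Longrightarrow> w q \<in> carrier_vec r" "\<And>q. q < m \<Longrightarrow> col A q = B *\<^sub>v w q" by metis
  define C where "C = mat r m (\<lambda>(i, q). w q $ i)"
  have C: "C \<in> carrier_mat r m" by (simp add: C_def)
  have "A = B * C"
  proof (rule mat_col_eqI)
    fix q assume "q < dim_col (B * C)"
    then have q: "q < m" using C by simp
    have "col C q = w q" using q w(1)[OF q] by (intro eq_vecI) (auto simp: C_def)
    then show "col A q = col (B * C) q"
      using w(2)[OF q] col_mult2[OF B C q] by simp
  qed (use A B C in auto)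
  then show ?thesis using C by blast
qed

section \<open>Graded matrices\<close>

text \<open>
  A map of degree 0 between graded free modules whose basis elements have the degrees
  \<open>\<beta>\<close> (source) and \<open>\<alpha>\<close> (target).
\<close>

definition graded_mat :: "int list \<Rightarrow> int list \<Rightarrow> ('v::finite, 'k::comm_ring_1) mpoly mat \<Rightarrow> bool" where
  "graded_mat \<alpha> \<beta> A \<longleftrightarrow> A \<in> carrier_mat (length \<alpha>) (length \<beta>) \<and>
     (\<forall>p<length \<alpha>. \<forall>q<length \<beta>. homogeneous (\<beta> ! q - \<alpha> ! p) (A $$ (p, q)))"

lemma graded_mat_carrier: "graded_mat \<alpha> \<beta> A \<Longrightarrow> A \<in> carrier_mat (length \<alpha>) (length \<beta>)"
  by (simp add: graded_mat_def)

lemma homogeneous_sum: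
  fixes f :: "'i \<Rightarrow> ('v::finite, 'k::comm_ring_1) mpoly"
  shows "(\<And>x. x \<in> S \<Longrightarrow> homogeneous d (f x)) \<Longrightarrow> homogeneous d (sum f S)"
  by (induction S rule: infinite_finite_induct) (simp_all add: homogeneous_add)

lemma index_mult_mat_sum:
  fixes A :: "'a::comm_ring_1 mat"
  assumes "A \<in> carrier_mat n m" "B \<in> carrier_mat m r" "p < n" "q < r"
  shows "(A * B) $$ (p, q) = (\<Sum>i<m. A $$ (p, i) * B $$ (i, q))"
  using assms by (simp add: scalar_prod_def atLeast0LessThan)

lemma graded_mat_mult:
  assumes A: "graded_mat \<alpha> \<beta> A" and B: "graded_mat \<beta> \<gamma> B"
  shows "graded_mat \<alpha> \<gamma> (A * B)"
  unfolding graded_mat_def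
proof (intro conjI allI impI)
  show "A * B \<in> carrier_mat (length \<alpha>) (length \<gamma>)"
    by (rule mult_carrier_mat[OF graded_mat_carrier[OF A] graded_mat_carrier[OF B]])
  fix p q assume p: "p < length \<alpha>" and q: "q < length \<gamma>"
  have "homogeneous (\<gamma> ! q - \<alpha> ! p) (A $$ (p, i) * B $$ (i, q))" if i: "i < length \<beta>" for i
    using homogeneous_mult[of "\<beta> ! i - \<alpha> ! p" "A $$ (p, i)" "\<gamma> ! q - \<beta> ! i" "B $$ (i, q)"] A B p q i
    unfolding graded_mat_def by simp
  then show "homogeneous (\<gamma> ! q - \<alpha> ! p) ((A * B) $$ (p, q))"
    unfolding index_mult_mat_sum[OF graded_mat_carrier[OF A] graded_mat_carrier[OF B] p q]
    by (intro homogeneous_sum) simp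
qed

text \<open>
  Any lift can be made homogeneous by keeping only the component of the required degree in each
  entry.
\<close>

lemma factor_graded_matrix:
  assumes A: "graded_mat \<alpha> \<beta> A" and B: "graded_mat \<alpha> \<gamma> B"
    and image: "\<And>v. v \<in> carrier_vec (length \<beta>) \<Longrightarrow> \<exists>w\<in>carrier_vec (length \<gamma>). A *\<^sub>v v = B *\<^sub>v w"
  shows "\<exists>C. graded_mat \<gamma> \<beta> C \<and> A = B * C"
proof -
  note cA = graded_mat_carrier[OF A] and cB = graded_mat_carrier[OF B]
  obtain C where C: "C \<in> carrier_mat (length \<gamma>) (length \<beta>)" "A = B * C"
    using factor_matrix[OF cA cB image] by blast
  define C' where "C' = mat (length \<gamma>) (length \<beta>) (\<lambda>(i, q). hom_comp (\<beta> ! q - \<gamma> ! i) (C $$ (i, q)))"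
  have C': "graded_mat \<gamma> \<beta> C'" by (simp add: graded_mat_def C'_def)
  have "A = B * C'"
  proof (rule eq_matI)
    fix p q assume "p < dim_row (B * C')" "q < dim_col (B * C')"
    then have p: "p < length \<alpha>" and q: "q < length \<beta>" using cB by (simp_all add: C'_def)
    have "homogeneous (\<beta> ! q - \<alpha> ! p) (A $$ (p, q))" using A p q by (simp add: graded_mat_def)
    then have "A $$ (p, q) = hom_comp (\<beta> ! q - \<alpha> ! p) (A $$ (p, q))" by (simp only: hom_comp_same)
    also have "\<dots> = hom_comp (\<beta> ! q - \<alpha> ! p) (\<Sum>i<length \<gamma>. B $$ (p, i) * C $$ (i, q))"
      unfolding C(2) index_mult_mat_sum[OF cB C(1) p q] ..
    also have "\<dots> = (\<Sum>i<length \<gamma>. B $$ (p, i) * C' $$ (i, q))"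
      unfolding hom_comp_sum
    proof (rule sum.cong[OF refl])
      fix i assume "i \<in> {..<length \<gamma>}"
      then have i: "i < length \<gamma>" by simp
      have "homogeneous (\<gamma> ! i - \<alpha> ! p) (B $$ (p, i))" using B p i by (simp add: graded_mat_def)
      then show "hom_comp (\<beta> ! q - \<alpha> ! p) (B $$ (p, i) * C $$ (i, q)) = B $$ (p, i) * C' $$ (i, q)"
        using i q by (simp add: hom_comp_mult C'_def)
    qed
    also have "\<dots> = (B * C') $$ (p, q)"
      by (rule index_mult_mat_sum[OF cB graded_mat_carrier[OF C'] p q, symmetric])
    finally show "A $$ (p, q) = (B * C') $$ (p, q)" .
  qed (use cA cB graded_mat_carrier[OF C'] in auto)
  then show ?thesis using C' by blast
qed

section \<open>Minimal free resolutions\<close>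

lemma minimal_free_resolutionD:
  assumes "minimal_free_resolution I \<delta> \<epsilon> D"
  shows mfr_augmentation: "\<epsilon> \<in> carrier_vec (length (\<delta> 0))"
    and mfr_augmentation_homogeneous: "p < length (\<delta> 0) \<Longrightarrow> homogeneous (\<delta> 0 ! p) (\<epsilon> $ p)"
    and mfr_graded: "graded_mat (\<delta> i) (\<delta> (Suc i)) (D i)"
    and mfr_surjective: "\<exists>v\<in>carrier_vec (length (\<delta> 0)). s - \<epsilon> \<bullet> v \<in> I"
    and mfr_exact_0: "v \<in> carrier_vec (length (\<delta> 0)) \<Longrightarrow>
      \<epsilon> \<bullet> v \<in> I \<longleftrightarrow> (\<exists>w\<in>carrier_vec (length (\<delta> 1)). v = D 0 *\<^sub>v w)"
    and mfr_exact: "v \<in> carrier_vec (length (\<delta> (Suc i))) \<Longrightarrow>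
      D i *\<^sub>v v = 0\<^sub>v (length (\<delta> i)) \<longleftrightarrow> (\<exists>w\<in>carrier_vec (length (\<delta> (Suc (Suc i)))). v = D (Suc i) *\<^sub>v w)"
    and mfr_minimal: "p < length (\<delta> i) \<Longrightarrow> q < length (\<delta> (Suc i)) \<Longrightarrow> D i $$ (p, q) \<in> irrelevant_ideal"
proof -
  note * = assms[unfolded minimal_free_resolution_def]
  show "\<epsilon> \<in> carrier_vec (length (\<delta> 0))" using * by (elim conjE)
  have "\<forall>p<length (\<delta> 0). homogeneous (\<delta> 0 ! p) (\<epsilon> $ p)" using * by (elim conjE)
  then show "p < length (\<delta> 0) \<Longrightarrow> homogeneous (\<delta> 0 ! p) (\<epsilon> $ p)" by simp
  have "\<forall>i. D i \<in> carrier_mat (length (\<delta> i)) (length (\<delta> (Suc i)))" using * by (elim conjE)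
  moreover have "\<forall>i. \<forall>p<length (\<delta> i). \<forall>q<length (\<delta> (Suc i)). homogeneous (\<delta> (Suc i) ! q - \<delta> i ! p) (D i $$ (p, q))"
    using * by (elim conjE)
  ultimately show "graded_mat (\<delta> i) (\<delta> (Suc i)) (D i)" unfolding graded_mat_def by simp
  have "\<forall>s. \<exists>v\<in>carrier_vec (length (\<delta> 0)). s - \<epsilon> \<bullet> v \<in> I" using * by (elim conjE)
  then show "\<exists>v\<in>carrier_vec (length (\<delta> 0)). s - \<epsilon> \<bullet> v \<in> I" by simp
  have e0: "{v \<in> carrier_vec (length (\<delta> 0)). \<epsilon> \<bullet> v \<in> I} = (\<lambda>w. D 0 *\<^sub>v w) ` carrier_vec (length (\<delta> 1))"
    using * by (elim conjE)
  show "v \<in> carrier_vec (length (\<delta> 0)) \<Longrightarrow>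
      \<epsilon> \<bullet> v \<in> I \<longleftrightarrow> (\<exists>w\<in>carrier_vec (length (\<delta> 1)). v = D 0 *\<^sub>v w)"
    using eqset_imp_iff[OF e0, of v] by (simp add: image_iff)
  have "\<forall>i. {v \<in> carrier_vec (length (\<delta> (Suc i))). D i *\<^sub>v v = 0\<^sub>v (length (\<delta> i))} =
       (\<lambda>w. D (Suc i) *\<^sub>v w) ` carrier_vec (length (\<delta> (Suc (Suc i))))"
    using * by (elim conjE)
  from spec[OF this, of i] have e: "{v \<in> carrier_vec (length (\<delta> (Suc i))). D i *\<^sub>v v = 0\<^sub>v (length (\<delta> i))} =
       (\<lambda>w. D (Suc i) *\<^sub>v w) ` carrier_vec (length (\<delta> (Suc (Suc i))))" .
  show "v \<in> carrier_vec (length (\<delta> (Suc i))) \<Longrightarrow>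
      D i *\<^sub>v v = 0\<^sub>v (length (\<delta> i)) \<longleftrightarrow> (\<exists>w\<in>carrier_vec (length (\<delta> (Suc (Suc i)))). v = D (Suc i) *\<^sub>v w)"
    using eqset_imp_iff[OF e, of v] by (simp add: image_iff)
  have "\<forall>i. \<forall>p<length (\<delta> i). \<forall>q<length (\<delta> (Suc i)). D i $$ (p, q) \<in> irrelevant_ideal"
    using * by (elim conjE)
  then show "p < length (\<delta> i) \<Longrightarrow> q < length (\<delta> (Suc i)) \<Longrightarrow> D i $$ (p, q) \<in> irrelevant_ideal" by simp
qed

lemma minimal_free_resolutionI:
  assumes "\<epsilon> \<in> carrier_vec (length (\<delta> 0))"
    and "\<And>p. p < length (\<delta> 0) \<Longrightarrow> homogeneous (\<delta> 0 ! p) (\<epsilon> $ p)"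
    and graded: "\<And>i. graded_mat (\<delta> i) (\<delta> (Suc i)) (D i)"
    and "\<And>s. \<exists>v\<in>carrier_vec (length (\<delta> 0)). s - \<epsilon> \<bullet> v \<in> I"
    and e0: "\<And>v. v \<in> carrier_vec (length (\<delta> 0)) \<Longrightarrow>
      \<epsilon> \<bullet> v \<in> I \<longleftrightarrow> (\<exists>w\<in>carrier_vec (length (\<delta> 1)). v = D 0 *\<^sub>v w)"
    and e: "\<And>i v. v \<in> carrier_vec (length (\<delta> (Suc i))) \<Longrightarrow>
      D i *\<^sub>v v = 0\<^sub>v (length (\<delta> i)) \<longleftrightarrow> (\<exists>w\<in>carrier_vec (length (\<delta> (Suc (Suc i)))). v = D (Suc i) *\<^sub>v w)"
    and "\<And>i p q. p < length (\<delta> i) \<Longrightarrow> q < length (\<delta> (Suc i)) \<Longrightarrow> D i $$ (p, q) \<in> irrelevant_ideal"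
  shows "minimal_free_resolution I \<delta> \<epsilon> D"
proof -
  have c: "D i *\<^sub>v w \<in> carrier_vec (length (\<delta> i))" if "w \<in> carrier_vec (length (\<delta> (Suc i)))" for i w
    using graded_mat_carrier[OF graded] that by (rule mult_mat_vec_carrier)
  have "{v \<in> carrier_vec (length (\<delta> 0)). \<epsilon> \<bullet> v \<in> I} = (\<lambda>w. D 0 *\<^sub>v w) ` carrier_vec (length (\<delta> 1))"
    using e0 c[of _ 0] by auto
  moreover have "{v \<in> carrier_vec (length (\<delta> (Suc i))). D i *\<^sub>v v = 0\<^sub>v (length (\<delta> i))} =
       (\<lambda>w. D (Suc i) *\<^sub>v w) ` carrier_vec (length (\<delta> (Suc (Suc i))))" for i
    using e[of _ i] c[of _ "Suc i"] by blast
  ultimately show ?thesis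
    using assms(1,2,4,7) graded graded_mat_carrier[OF graded]
    unfolding minimal_free_resolution_def graded_mat_def by (intro conjI) simp_all
qed

section \<open>Comparison of resolutions\<close>

lemma minimal_free_resolution_complex:
  assumes res: "minimal_free_resolution I \<delta> \<epsilon> D"
  shows "D i * D (Suc i) = 0\<^sub>m (length (\<delta> i)) (length (\<delta> (Suc (Suc i))))"
proof (rule eq_mat_if_mult_vec_eq)
  note c = graded_mat_carrier[OF mfr_graded[OF res]]
  show "D i * D (Suc i) \<in> carrier_mat (length (\<delta> i)) (length (\<delta> (Suc (Suc i))))"
    using c by (rule mult_carrier_mat[OF c])
  fix v :: "('a, 'b) mpoly vec" assume v: "v \<in> carrier_vec (length (\<delta> (Suc (Suc i))))"
  have "D i *\<^sub>v (D (Suc i) *\<^sub>v v) = 0\<^sub>v (length (\<delta> i))"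
    using mfr_exact[OF res mult_mat_vec_carrier[OF c v]] v by blast
  then show "D i * D (Suc i) *\<^sub>v v = 0\<^sub>m (length (\<delta> i)) (length (\<delta> (Suc (Suc i)))) *\<^sub>v v"
    using assoc_mult_mat_vec[OF c c v] zero_mat_mult_vec[OF v] by simp
qed simp

text \<open>
  The step at the augmentation: preimages under \<open>\<epsilon>'\<close> of the classes
  \<open>\<epsilon> $ q\<close> are chosen and made homogeneous, which is harmless modulo
  \<open>I\<close> because \<open>I\<close> is graded.
\<close>

lemma comparison_map_0:
  assumes I: "graded_ideal I"
    and F: "minimal_free_resolution I \<delta> \<epsilon> D" and G: "minimal_free_resolution I \<delta>' \<epsilon>' D'"
  shows "\<exists>\<phi>. graded_mat (\<delta>' 0) (\<delta> 0) \<phi> \<and>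
    (\<forall>v\<in>carrier_vec (length (\<delta> 0)). \<epsilon>' \<bullet> (\<phi> *\<^sub>v v) - \<epsilon> \<bullet> v \<in> I)"
proof -
  let ?n = "length (\<delta> 0)" and ?m = "length (\<delta>' 0)"
  have I': "is_ideal I" using I by (simp add: graded_ideal_def)
  have "\<exists>w. w \<in> carrier_vec ?m \<and> \<epsilon> $ q - \<epsilon>' \<bullet> w \<in> I" for q
    using mfr_surjective[OF G] by blast
  then obtain w where w: "\<And>q. w q \<in> carrier_vec ?m" "\<And>q. \<epsilon> $ q - \<epsilon>' \<bullet> w q \<in> I" by metis
  define \<phi> where "\<phi> = mat ?m ?n (\<lambda>(p, q). hom_comp (\<delta> 0 ! q - \<delta>' 0 ! p) (w q $ p))"
  have gr: "graded_mat (\<delta>' 0) (\<delta> 0) \<phi>" by (simp add: graded_mat_def \<phi>_def)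
  note c = graded_mat_carrier[OF gr]
  have col: "\<epsilon>' \<bullet> col \<phi> q - \<epsilon> $ q \<in> I" if q: "q < ?n" for q
  proof -
    have "hom_comp (\<delta> 0 ! q) (\<epsilon>' \<bullet> w q) = (\<Sum>p<?m. hom_comp (\<delta> 0 ! q) (\<epsilon>' $ p * w q $ p))"
      using w(1)[of q] by (simp add: scalar_prod_def hom_comp_sum atLeast0LessThan)
    also have "\<dots> = (\<Sum>p<?m. \<epsilon>' $ p * \<phi> $$ (p, q))"
    proof (rule sum.cong[OF refl])
      fix p assume "p \<in> {..<?m}"
      then have p: "p < ?m" by simp
      show "hom_comp (\<delta> 0 ! q) (\<epsilon>' $ p * w q $ p) = \<epsilon>' $ p * \<phi> $$ (p, q)"
        using hom_comp_mult[OF mfr_augmentation_homogeneous[OF G p]] p q by (simp add: \<phi>_def)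
    qed
    also have "\<dots> = \<epsilon>' \<bullet> col \<phi> q"
      using c q by (simp add: scalar_prod_def atLeast0LessThan)
    finally have "hom_comp (\<delta> 0 ! q) (\<epsilon> $ q - \<epsilon>' \<bullet> w q) = \<epsilon> $ q - \<epsilon>' \<bullet> col \<phi> q"
      using mfr_augmentation_homogeneous[OF F q] by (simp add: hom_comp_diff hom_comp_homogeneous)
    then have "\<epsilon> $ q - \<epsilon>' \<bullet> col \<phi> q \<in> I" using I w(2)[of q] unfolding graded_ideal_def by metis
    from ideal.subspace_neg[OF I' this] show ?thesis by simp
  qed
  have "\<epsilon>' \<bullet> (\<phi> *\<^sub>v v) - \<epsilon> \<bullet> v \<in> I" if v: "v \<in> carrier_vec ?n" for v
  proof -
    have "\<epsilon>' \<bullet> (\<phi> *\<^sub>v v) = (\<Sum>p<?m. \<epsilon>' $ p * (\<Sum>q<?n. \<phi> $$ (p, q) * v $ q))"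
      using c v by (simp add: scalar_prod_def atLeast0LessThan)
    also have "\<dots> = (\<Sum>q<?n. (\<Sum>p<?m. \<epsilon>' $ p * \<phi> $$ (p, q)) * v $ q)"
      unfolding sum_distrib_left sum_distrib_right by (subst sum.swap) (simp add: mult.assoc)
    also have "\<dots> = (\<Sum>q<?n. (\<epsilon>' \<bullet> col \<phi> q) * v $ q)"
      using c by (intro sum.cong refl) (simp add: scalar_prod_def atLeast0LessThan)
    finally have "\<epsilon>' \<bullet> (\<phi> *\<^sub>v v) - \<epsilon> \<bullet> v = (\<Sum>q<?n. v $ q * (\<epsilon>' \<bullet> col \<phi> q - \<epsilon> $ q))"
      using v by (simp add: scalar_prod_def[of \<epsilon>] atLeast0LessThan right_diff_distrib sum_subtractf mult.commute)
    then show ?thesis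
      using col by (simp only:) (intro ideal.subspace_sum[OF I'] ideal.subspace_scale[OF I'], simp)
  qed
  then show ?thesis using gr by blast
qed

text \<open>
  The comparison theorem. A partial chain map \<open>\<phi>\<close> up to step \<open>i\<close>
  extends as soon as \<open>\<phi> * D i\<close> takes values in the image of \<open>D' i\<close>;
  this condition is part of the invariant, since exactness restores it at each step.
\<close>

lemma comparison_map:
  assumes I: "graded_ideal I"
    and F: "minimal_free_resolution I \<delta> \<epsilon> D" and G: "minimal_free_resolution I \<delta>' \<epsilon>' D'"
  shows "\<exists>\<phi>. (\<forall>i. graded_mat (\<delta>' i) (\<delta> i) (\<phi> i)) \<and> (\<forall>i. D' i * \<phi> (Suc i) = \<phi> i * D i) \<and>
    (\<forall>v\<in>carrier_vec (length (\<delta> 0)). \<epsilon>' \<bullet> (\<phi> 0 *\<^sub>v v) - \<epsilon> \<bullet> v \<in> I)"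
proof -
  have I': "is_ideal I" using I by (simp add: graded_ideal_def)
  note cD = graded_mat_carrier[OF mfr_graded[OF F]] and cD' = graded_mat_carrier[OF mfr_graded[OF G]]
  (* The augmentation condition concerns only the first map; it is kept in the invariant so that
     one choice of the sequence yields all properties. *)
  define good where "good i \<phi> \<longleftrightarrow> graded_mat (\<delta>' i) (\<delta> i) \<phi> \<and>
    (\<forall>v\<in>carrier_vec (length (\<delta> (Suc i))). \<exists>w\<in>carrier_vec (length (\<delta>' (Suc i))). \<phi> * D i *\<^sub>v v = D' i *\<^sub>v w) \<and>
    (i = 0 \<longrightarrow> (\<forall>v\<in>carrier_vec (length (\<delta> 0)). \<epsilon>' \<bullet> (\<phi> *\<^sub>v v) - \<epsilon> \<bullet> v \<in> I))" for i \<phi>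
  have "\<exists>\<phi>. good 0 \<phi>"
  proof -
    obtain \<phi> where \<phi>: "graded_mat (\<delta>' 0) (\<delta> 0) \<phi>"
      "\<And>v. v \<in> carrier_vec (length (\<delta> 0)) \<Longrightarrow> \<epsilon>' \<bullet> (\<phi> *\<^sub>v v) - \<epsilon> \<bullet> v \<in> I"
      using comparison_map_0[OF assms] by blast
    note c = graded_mat_carrier[OF \<phi>(1)]
    have "\<exists>w\<in>carrier_vec (length (\<delta>' (Suc 0))). \<phi> * D 0 *\<^sub>v v = D' 0 *\<^sub>v w"
      if v: "v \<in> carrier_vec (length (\<delta> (Suc 0)))" for v
    proof -
      have Dv: "D 0 *\<^sub>v v \<in> carrier_vec (length (\<delta> 0))" by (rule mult_mat_vec_carrier[OF cD v])
      then have "\<epsilon> \<bullet> (D 0 *\<^sub>v v) \<in> I" using mfr_exact_0[OF F Dv] v by auto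
      from ideal.subspace_add[OF I' \<phi>(2)[OF Dv] this]
      have "\<epsilon>' \<bullet> (\<phi> *\<^sub>v (D 0 *\<^sub>v v)) \<in> I" by simp
      then show ?thesis
        using mfr_exact_0[OF G mult_mat_vec_carrier[OF c Dv]] assoc_mult_mat_vec[OF c cD v] by simp
    qed
    then show ?thesis unfolding good_def using \<phi> by blast
  qed
  moreover have "\<exists>\<psi>. good (Suc i) \<psi> \<and> D' i * \<psi> = \<phi> * D i" if \<phi>: "good i \<phi>" for i \<phi>
  proof -
    have g\<phi>: "graded_mat (\<delta>' i) (\<delta> i) \<phi>" using \<phi> by (simp add: good_def)
    note c = graded_mat_carrier[OF g\<phi>]
    obtain \<psi> where \<psi>: "graded_mat (\<delta>' (Suc i)) (\<delta> (Suc i)) \<psi>" "\<phi> * D i = D' i * \<psi>"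
      using factor_graded_matrix[OF graded_mat_mult[OF g\<phi> mfr_graded[OF F]] mfr_graded[OF G]] \<phi>
      unfolding good_def by metis
    note c\<psi> = graded_mat_carrier[OF \<psi>(1)]
    have "\<exists>w\<in>carrier_vec (length (\<delta>' (Suc (Suc i)))). \<psi> * D (Suc i) *\<^sub>v v = D' (Suc i) *\<^sub>v w"
      if v: "v \<in> carrier_vec (length (\<delta> (Suc (Suc i))))" for v
    proof -
      have "D' i * (\<psi> * D (Suc i)) = \<phi> * (D i * D (Suc i))"
        unfolding assoc_mult_mat[OF cD' c\<psi> cD, symmetric] \<psi>(2)[symmetric] by (rule assoc_mult_mat[OF c cD cD])
      also have "\<dots> = 0\<^sub>m (length (\<delta>' i)) (length (\<delta> (Suc (Suc i))))"
        unfolding minimal_free_resolution_complex[OF F] by (rule right_mult_zero_mat[OF c])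
      finally have zero: "D' i * (\<psi> * D (Suc i)) = 0\<^sub>m (length (\<delta>' i)) (length (\<delta> (Suc (Suc i))))" .
      have cc: "\<psi> * D (Suc i) \<in> carrier_mat (length (\<delta>' (Suc i))) (length (\<delta> (Suc (Suc i))))"
        by (rule mult_carrier_mat[OF c\<psi> cD])
      have "D' i *\<^sub>v (\<psi> * D (Suc i) *\<^sub>v v) = 0\<^sub>v (length (\<delta>' i))"
        unfolding assoc_mult_mat_vec[OF cD' cc v, symmetric] zero by (rule zero_mat_mult_vec[OF v])
      then show ?thesis using mfr_exact[OF G mult_mat_vec_carrier[OF cc v]] by blast
    qed
    then show ?thesis unfolding good_def using \<psi> by auto
  qed
  ultimately obtain \<phi> where "\<forall>i. good i (\<phi> i)" "\<forall>i. D' i * \<phi> (Suc i) = \<phi> i * D i"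
    using dependent_nat_choice[of good "\<lambda>i \<phi> \<psi>. D' i * \<psi> = \<phi> * D i"] by auto
  then show ?thesis unfolding good_def by (intro exI[of _ \<phi>]) auto
qed

definition irrelevant_mat :: "('v, 'k::zero) mpoly mat \<Rightarrow> bool" where
  "irrelevant_mat A \<longleftrightarrow> (\<forall>p<dim_row A. \<forall>q<dim_col A. A $$ (p, q) \<in> irrelevant_ideal)"

lemma irrelevant_mat_mult:
  fixes A :: "('v::finite, 'k::comm_ring_1) mpoly mat"
  assumes A: "A \<in> carrier_mat n m" and B: "B \<in> carrier_mat m r" and irr: "irrelevant_mat A \<or> irrelevant_mat B"
  shows "irrelevant_mat (A * B)"
  unfolding irrelevant_mat_def
proof (intro allI impI)
  fix p q assume "p < dim_row (A * B)" "q < dim_col (A * B)"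
  then have p: "p < n" and q: "q < r" using A B by auto
  have "A $$ (p, i) * B $$ (i, q) \<in> irrelevant_ideal" if "i < m" for i
  proof -
    have "A $$ (p, i) \<in> irrelevant_ideal \<or> B $$ (i, q) \<in> irrelevant_ideal"
      using irr A B p q that unfolding irrelevant_mat_def by auto
    then show ?thesis
      using ideal.subspace_scale[OF irrelevant_ideal_is_ideal] mult.commute by metis
  qed
  then show "(A * B) $$ (p, q) \<in> irrelevant_ideal"
    unfolding index_mult_mat_sum[OF A B p q] by (intro ideal.subspace_sum[OF irrelevant_ideal_is_ideal]) simp
qed

lemma irrelevant_mat_add:
  fixes A :: "('v::finite, 'k::comm_ring_1) mpoly mat"
  assumes "A \<in> carrier_mat n m" "B \<in> carrier_mat n m" "irrelevant_mat A" "irrelevant_mat B"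
  shows "irrelevant_mat (A + B)"
  unfolding irrelevant_mat_def
proof (intro allI impI)
  fix p q assume "p < dim_row (A + B)" "q < dim_col (A + B)"
  then have "(A + B) $$ (p, q) = A $$ (p, q) + B $$ (p, q)"
    and "A $$ (p, q) \<in> irrelevant_ideal" "B $$ (p, q) \<in> irrelevant_ideal"
    using assms unfolding irrelevant_mat_def by auto
  then show "(A + B) $$ (p, q) \<in> irrelevant_ideal"
    using ideal.subspace_add[OF irrelevant_ideal_is_ideal] by metis
qed

text \<open>
  A chain endomorphism over the identity of \<open>S/I\<close> is homotopic to the identity. The
  difference \<open>T = \<theta> - 1\<close> is \<open>D\<^sub>i H + H'
  D\<^sub>i\<^sub>-\<^sub>1\<close>, and both summands have entries in the irrelevant ideal because
  the resolution is minimal. The next homotopy depends only on the relation \<open>T\<^sub>i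
  D\<^sub>i = D\<^sub>i H D\<^sub>i\<close>, which therefore serves as the induction invariant.
\<close>

lemma chain_endomorphism_minus_one_irrelevant:
  assumes I: "is_ideal I" and F: "minimal_free_resolution I \<delta> \<epsilon> D"
    and \<theta>: "\<And>i. \<theta> i \<in> carrier_mat (length (\<delta> i)) (length (\<delta> i))"
    and chain: "\<And>i. D i * \<theta> (Suc i) = \<theta> i * D i"
    and augmentation: "\<And>v. v \<in> carrier_vec (length (\<delta> 0)) \<Longrightarrow> \<epsilon> \<bullet> (\<theta> 0 *\<^sub>v v) - \<epsilon> \<bullet> v \<in> I"
  shows "irrelevant_mat (\<theta> i - 1\<^sub>m (length (\<delta> i)))"
proof -
  define n where "n i = length (\<delta> i)" for i
  define T where "T i = \<theta> i - 1\<^sub>m (n i)" for i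
  have cD: "D i \<in> carrier_mat (n i) (n (Suc i))" for i
    using graded_mat_carrier[OF mfr_graded[OF F]] by (simp add: n_def)
  have c\<theta>: "\<theta> i \<in> carrier_mat (n i) (n i)" for i using \<theta> by (simp add: n_def)
  have cT: "T i \<in> carrier_mat (n i) (n i)" for i by (simp add: T_def minus_carrier_mat)
  have irrD: "irrelevant_mat (D i)" for i
    using mfr_minimal[OF F, of _ i] cD[of i] unfolding irrelevant_mat_def n_def by auto
  have chainT: "D i * T (Suc i) = T i * D i" for i
    unfolding T_def mult_minus_distrib_mat[OF cD c\<theta> one_carrier_mat] minus_mult_distrib_mat[OF c\<theta> one_carrier_mat cD]
    unfolding right_mult_one_mat[OF cD] left_mult_one_mat[OF cD] chain ..
  have "irrelevant_mat (T i) \<and> (\<exists>H\<in>carrier_mat (n (Suc i)) (n i). T i * D i = D i * H * D i)"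
  proof (induction i)
    case 0
    have "\<exists>w\<in>carrier_vec (n (Suc 0)). T 0 *\<^sub>v v = D 0 *\<^sub>v w" if v: "v \<in> carrier_vec (n 0)" for v
    proof -
      have \<epsilon>: "\<epsilon> \<in> carrier_vec (n 0)" using mfr_augmentation[OF F] by (simp add: n_def)
      have "T 0 *\<^sub>v v = \<theta> 0 *\<^sub>v v - v"
        unfolding T_def minus_mult_distrib_mat_vec[OF c\<theta> one_carrier_mat v] using v by simp
      then have "\<epsilon> \<bullet> (T 0 *\<^sub>v v) = \<epsilon> \<bullet> (\<theta> 0 *\<^sub>v v) - \<epsilon> \<bullet> v"
        using scalar_prod_minus_distrib[OF \<epsilon> mult_mat_vec_carrier[OF c\<theta> v] v] by simp
      then have "\<epsilon> \<bullet> (T 0 *\<^sub>v v) \<in> I" using augmentation v by (simp add: n_def)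
      then show ?thesis using mfr_exact_0[OF F, of "T 0 *\<^sub>v v"] mult_mat_vec_carrier[OF cT v] by (simp add: n_def)
    qed
    from factor_matrix[OF cT cD this] obtain H where H: "H \<in> carrier_mat (n (Suc 0)) (n 0)" "T 0 = D 0 * H" by blast
    then show ?case using irrelevant_mat_mult[OF cD H(1)] irrD by auto
  next
    case (Suc i)
    then obtain H where H: "H \<in> carrier_mat (n (Suc i)) (n i)" and eq: "T i * D i = D i * H * D i" by blast
    let ?T = "T (Suc i) - H * D i"
    have cHD: "H * D i \<in> carrier_mat (n (Suc i)) (n (Suc i))" by (rule mult_carrier_mat[OF H cD])
    have cT': "?T \<in> carrier_mat (n (Suc i)) (n (Suc i))" by (rule minus_carrier_mat[OF cHD])
    have "D i * ?T = D i * T (Suc i) - D i * (H * D i)" by (rule mult_minus_distrib_mat[OF cD cT cHD])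
    also have "\<dots> = 0\<^sub>m (n i) (n (Suc i))"
      unfolding chainT eq assoc_mult_mat[OF cD H cD] by (rule minus_r_inv_mat[OF mult_carrier_mat[OF cD cHD]])
    finally have zero: "D i * ?T = 0\<^sub>m (n i) (n (Suc i))" .
    have "\<exists>w\<in>carrier_vec (n (Suc (Suc i))). ?T *\<^sub>v v = D (Suc i) *\<^sub>v w" if v: "v \<in> carrier_vec (n (Suc i))" for v
    proof -
      have "D i *\<^sub>v (?T *\<^sub>v v) = 0\<^sub>v (n i)"
        unfolding assoc_mult_mat_vec[OF cD cT' v, symmetric] zero by (rule zero_mat_mult_vec[OF v])
      then show ?thesis
        using mfr_exact[OF F, of "?T *\<^sub>v v" i] mult_mat_vec_carrier[OF cT' v] by (simp add: n_def)
    qed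
    from factor_matrix[OF cT' cD this] obtain H'
      where H': "H' \<in> carrier_mat (n (Suc (Suc i))) (n (Suc i))" "?T = D (Suc i) * H'" by blast
    have cDH': "D (Suc i) * H' \<in> carrier_mat (n (Suc i)) (n (Suc i))" by (rule mult_carrier_mat[OF cD H'(1)])
    have "T (Suc i) = ?T + H * D i"
      by (rule eq_matI) (use cT[of "Suc i"] cHD in auto)
    then have T: "T (Suc i) = D (Suc i) * H' + H * D i" unfolding H'(2) .
    have "irrelevant_mat (T (Suc i))"
      unfolding T using irrelevant_mat_mult[OF cD H'(1)] irrelevant_mat_mult[OF H cD] irrD
      by (intro irrelevant_mat_add[OF cDH' cHD]) blast+
    moreover have "T (Suc i) * D (Suc i) = D (Suc i) * H' * D (Suc i)"
    proof -
      have "H * D i * D (Suc i) = H * 0\<^sub>m (n i) (n (Suc (Suc i)))"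
        unfolding assoc_mult_mat[OF H cD cD] minimal_free_resolution_complex[OF F] n_def ..
      also have "\<dots> = 0\<^sub>m (n (Suc i)) (n (Suc (Suc i)))" by (rule right_mult_zero_mat[OF H])
      finally show ?thesis
        unfolding T add_mult_distrib_mat[OF cDH' cHD cD]
        using right_add_zero_mat[OF mult_carrier_mat[OF cDH' cD]] by simp
    qed
    ultimately show ?case using H'(1) by blast
  qed
  then show ?thesis by (simp add: T_def n_def)
qed

text \<open>
  The entry of \<open>\<psi>\<phi>\<close> at \<open>(q, q)\<close> is congruent to \<open>1\<close>
  modulo the irrelevant ideal. If the degree of the basis element \<open>q\<close> did not occur in
  the second resolution, all entries in its column of \<open>\<phi>\<close> would be forms of
  nonzero degree, and that entry would be congruent to \<open>0\<close>.
\<close>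

lemma resolution_degrees_subset:
  assumes I: "graded_ideal I"
    and F: "minimal_free_resolution I \<delta> \<epsilon> D" and G: "minimal_free_resolution I \<delta>' \<epsilon>' D'"
  shows "set (\<delta> i) \<subseteq> set (\<delta>' i)"
proof
  fix j assume "j \<in> set (\<delta> i)"
  then obtain q where q: "q < length (\<delta> i)" "j = \<delta> i ! q" by (auto simp: in_set_conv_nth)
  show "j \<in> set (\<delta>' i)"
  proof (rule ccontr)
    assume j: "j \<notin> set (\<delta>' i)"
    have I': "is_ideal I" using I by (simp add: graded_ideal_def)
    obtain \<phi> where \<phi>: "\<And>i. graded_mat (\<delta>' i) (\<delta> i) (\<phi> i)" "\<And>i. D' i * \<phi> (Suc i) = \<phi> i * D i"
      "\<And>v. v \<in> carrier_vec (length (\<delta> 0)) \<Longrightarrow> \<epsilon>' \<bullet> (\<phi> 0 *\<^sub>v v) - \<epsilon> \<bullet> v \<in> I"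
      using comparison_map[OF I F G] by blast
    obtain \<psi> where \<psi>: "\<And>i. graded_mat (\<delta> i) (\<delta>' i) (\<psi> i)" "\<And>i. D i * \<psi> (Suc i) = \<psi> i * D' i"
      "\<And>v. v \<in> carrier_vec (length (\<delta>' 0)) \<Longrightarrow> \<epsilon> \<bullet> (\<psi> 0 *\<^sub>v v) - \<epsilon>' \<bullet> v \<in> I"
      using comparison_map[OF I G F] by blast
    note c\<phi> = graded_mat_carrier[OF \<phi>(1)] and c\<psi> = graded_mat_carrier[OF \<psi>(1)]
      and cD = graded_mat_carrier[OF mfr_graded[OF F]] and cD' = graded_mat_carrier[OF mfr_graded[OF G]]
    have "irrelevant_mat (\<psi> i * \<phi> i - 1\<^sub>m (length (\<delta> i)))"
    proof (rule chain_endomorphism_minus_one_irrelevant[OF I' F])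
      show "\<psi> i * \<phi> i \<in> carrier_mat (length (\<delta> i)) (length (\<delta> i))" for i
        by (rule mult_carrier_mat[OF c\<psi> c\<phi>])
      show "D i * (\<psi> (Suc i) * \<phi> (Suc i)) = \<psi> i * \<phi> i * D i" for i
        unfolding assoc_mult_mat[OF cD c\<psi> c\<phi>, symmetric] \<psi>(2) assoc_mult_mat[OF c\<psi> cD' c\<phi>] \<phi>(2)
        by (rule assoc_mult_mat[OF c\<psi> c\<phi> cD, symmetric])
      fix v :: "('a, 'b) mpoly vec" assume v: "v \<in> carrier_vec (length (\<delta> 0))"
      from ideal.subspace_add[OF I' \<psi>(3)[OF mult_mat_vec_carrier[OF c\<phi> v]] \<phi>(3)[OF v]]
      show "\<epsilon> \<bullet> (\<psi> 0 * \<phi> 0 *\<^sub>v v) - \<epsilon> \<bullet> v \<in> I"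
        unfolding assoc_mult_mat_vec[OF c\<psi> c\<phi> v] by simp
    qed
    then have "(\<psi> i * \<phi> i - 1\<^sub>m (length (\<delta> i))) $$ (q, q) \<in> irrelevant_ideal"
      using q(1) unfolding irrelevant_mat_def index_minus_mat(2,3) index_one_mat(2,3) by blast
    then have diff: "(\<psi> i * \<phi> i) $$ (q, q) - 1 \<in> irrelevant_ideal"
      using q(1) by (simp del: index_mult_mat(1))
    have "\<psi> i $$ (q, p) * \<phi> i $$ (p, q) \<in> irrelevant_ideal" if p: "p < length (\<delta>' i)" for p
    proof -
      have "\<delta> i ! q - \<delta>' i ! p \<noteq> 0" using j q(2) p nth_mem by fastforce
      then have "\<phi> i $$ (p, q) \<in> irrelevant_ideal"
        using \<phi>(1)[of i] p q(1) unfolding graded_mat_def by (blast intro: homogeneous_in_irrelevant_ideal)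
      then show ?thesis by (rule ideal.subspace_scale[OF irrelevant_ideal_is_ideal])
    qed
    then have "(\<psi> i * \<phi> i) $$ (q, q) \<in> irrelevant_ideal"
      unfolding index_mult_mat_sum[OF c\<psi> c\<phi> q(1) q(1)]
      by (intro ideal.subspace_sum[OF irrelevant_ideal_is_ideal]) simp
    from ideal.subspace_diff[OF irrelevant_ideal_is_ideal this diff]
    have "(1 :: ('a, 'b) mpoly) \<in> irrelevant_ideal" by simp
    then show False using one_notin_irrelevant_ideal by blast
  qed
qed

section \<open>The mapping cone\<close>

lemma carrier_vec_add_split:
  assumes "v \<in> carrier_vec (n + m)"
  obtains u w where "u \<in> carrier_vec n" "w \<in> carrier_vec m" "v = u @\<^sub>v w"
  using vec_first_last_append[OF assms] vec_first_carrier vec_last_carrier by metis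

lemma carrier_vec_0: "v \<in> carrier_vec 0 \<Longrightarrow> v = 0\<^sub>v 0"
  by (intro eq_vecI) auto

lemma append_vec_empty: "w \<in> carrier_vec 0 \<Longrightarrow> v @\<^sub>v w = v"
  by (intro eq_vecI) auto

lemma append_zero_vec: "0\<^sub>v n @\<^sub>v 0\<^sub>v m = (0\<^sub>v (n + m) :: 'a::zero vec)"
  by (intro eq_vecI) auto

text \<open>
  The mapping cone of \<open>f: F(-a) \<rightarrow> F\<close> has \<open>F\<^sub>i \<oplus>
  F\<^sub>i\<^sub>-\<^sub>1(-a)\<close> in homological degree \<open>i\<close>; on degree \<open>i +
  1\<close> the differential is \<open>(u, w) \<mapsto> (D\<^sub>i u \<plusminus> f w,
  D\<^sub>i\<^sub>-\<^sub>1 w)\<close>. A cycle \<open>(u, w)\<close> is a boundary because first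
  \<open>w = D\<^sub>i y\<close>, by exactness of \<open>F\<close> or, for \<open>i = 0\<close>,
  because \<open>f\<close> is a nonzerodivisor modulo \<open>J\<close>, and then \<open>u
  \<plusminus> f y\<close> is a cycle of \<open>F\<close>. Minimality is kept since \<open>f\<close>
  has positive degree.
\<close>

lemma mapping_cone:
  fixes f :: "('v::finite, 'k::comm_ring_1) mpoly"
  assumes J: "is_ideal J" and F: "minimal_free_resolution J \<delta> \<epsilon> D"
    and f: "homogeneous a f" and a: "a > 0"
    and regular: "\<And>g. f * g \<in> J \<Longrightarrow> g \<in> J"
  shows "\<exists>D'. minimal_free_resolution {j + f * g | j g. j \<in> J}
    (\<lambda>i. \<delta> i @ (case i of 0 \<Rightarrow> [] | Suc k \<Rightarrow> map (\<lambda>d. d + a) (\<delta> k))) \<epsilon> D'"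
proof -
  define n where "n i = length (\<delta> i)" for i
  define \<tau> where "\<tau> i = (case i of 0 \<Rightarrow> [] | Suc k \<Rightarrow> map (\<lambda>d. d + a) (\<delta> k))" for i
  define t where "t i = length (\<tau> i)" for i
  have t: "t 0 = 0" "t (Suc i) = n i" for i by (simp_all add: t_def \<tau>_def n_def)
  (* The sign of f alternates so that the differential squares to zero without signs on D. *)
  define g where "g i = (if even i then f else - f)" for i :: nat
  have g_Suc: "g (Suc i) = - g i" for i by (simp add: g_def)
  have g_hom: "homogeneous a (g i)" for i using f by (simp add: g_def)
  (* The component F_i(-a) -> F_(i-1)(-a) of the differential; below F_0 it has no rows. *)
  define L where "L i = (case i of 0 \<Rightarrow> 0\<^sub>m 0 (n 0) | Suc k \<Rightarrow> D k)" for i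
  define C where "C i = four_block_mat (D i) (g i \<cdot>\<^sub>m 1\<^sub>m (n i)) (0\<^sub>m (t i) (n (Suc i))) (L i)" for i
  have gr: "graded_mat (\<delta> i) (\<delta> (Suc i)) (D i)" for i by (rule mfr_graded[OF F])
  have cD: "D i \<in> carrier_mat (n i) (n (Suc i))" for i
    using graded_mat_carrier[OF gr] by (simp add: n_def)
  have cL: "L i \<in> carrier_mat (t i) (n i)" for i
    using cD by (cases i) (simp_all add: L_def t)
  have \<epsilon>: "\<epsilon> \<in> carrier_vec (n 0)" using mfr_augmentation[OF F] by (simp add: n_def)
  have length: "length (\<delta> i @ \<tau> i) = n i + t i" for i by (simp add: n_def t_def)
  have exact_0: "\<epsilon> \<bullet> v \<in> J \<longleftrightarrow> (\<exists>w\<in>carrier_vec (n (Suc 0)). v = D 0 *\<^sub>v w)" if "v \<in> carrier_vec (n 0)" for v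
    using mfr_exact_0[OF F] that by (simp add: n_def)
  have exact: "D i *\<^sub>v v = 0\<^sub>v (n i) \<longleftrightarrow> (\<exists>w\<in>carrier_vec (n (Suc (Suc i))). v = D (Suc i) *\<^sub>v w)"
    if "v \<in> carrier_vec (n (Suc i))" for v i
    using mfr_exact[OF F] that by (simp add: n_def)
  have mult_C: "C i *\<^sub>v (u @\<^sub>v w) = (D i *\<^sub>v u + g i \<cdot>\<^sub>v w) @\<^sub>v (L i *\<^sub>v w)"
    if u: "u \<in> carrier_vec (n (Suc i))" and w: "w \<in> carrier_vec (n i)" for i u w
  proof -
    have "g i \<cdot>\<^sub>m 1\<^sub>m (n i) *\<^sub>v w = g i \<cdot>\<^sub>v w"
      unfolding smult_mat_mult_vec[OF one_carrier_mat w] using w by simp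
    moreover have "0\<^sub>m (t i) (n (Suc i)) *\<^sub>v u + L i *\<^sub>v w = L i *\<^sub>v w"
      unfolding zero_mat_mult_vec[OF u] by (rule left_zero_vec[OF mult_mat_vec_carrier[OF cL w]])
    moreover have "g i \<cdot>\<^sub>m 1\<^sub>m (n i) \<in> carrier_mat (n i) (n i)" by simp
    ultimately show ?thesis
      unfolding C_def using four_block_mat_mult_vec[OF cD _ zero_carrier_mat cL u w] by metis
  qed
  have carrier_top: "D i *\<^sub>v u + g i \<cdot>\<^sub>v w \<in> carrier_vec (n i)"
    if u: "u \<in> carrier_vec (n (Suc i))" and w: "w \<in> carrier_vec (n i)" for i u w
    using mult_mat_vec_carrier[OF cD u] w by simp
  have index_C: "C i $$ (p, q) = (if p < n i then if q < n (Suc i) then D i $$ (p, q)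
        else if p = q - n (Suc i) then g i else 0
      else if q < n (Suc i) then 0 else L i $$ (p - n i, q - n (Suc i)))"
    if "p < n i + t i" "q < n (Suc i) + n i" for i p q
    using that cD[of i] cL[of i] unfolding C_def by (subst index_mat_four_block) auto
  have "minimal_free_resolution {j + f * g | j g. j \<in> J} (\<lambda>i. \<delta> i @ \<tau> i) \<epsilon> C"
  proof (rule minimal_free_resolutionI)
    show "\<epsilon> \<in> carrier_vec (length (\<delta> 0 @ \<tau> 0))" unfolding length using \<epsilon> t by simp
    show "homogeneous ((\<delta> 0 @ \<tau> 0) ! p) (\<epsilon> $ p)" if "p < length (\<delta> 0 @ \<tau> 0)" for p
      using that mfr_augmentation_homogeneous[OF F, of p] by (simp add: \<tau>_def)
    show "graded_mat (\<delta> i @ \<tau> i) (\<delta> (Suc i) @ \<tau> (Suc i)) (C i)" for i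
      unfolding graded_mat_def length t
    proof (intro conjI allI impI)
      show "C i \<in> carrier_mat (n i + t i) (n (Suc i) + n i)"
        unfolding C_def by (rule four_block_carrier_mat[OF cD cL])
      fix p q assume p: "p < n i + t i" and q: "q < n (Suc i) + n i"
      have D_hom: "homogeneous (\<delta> (Suc i) ! q - \<delta> i ! p) (D i $$ (p, q))" if "p < n i" "q < n (Suc i)" for p q i
        using gr[of i] that unfolding graded_mat_def n_def by simp
      have L_hom: "homogeneous (\<tau> (Suc i) ! q - \<tau> i ! p) (L i $$ (p, q))" if "p < t i" "q < n i" for p q
      proof (cases i)
        case 0
        then show ?thesis using that t by simp
      next
        case (Suc k)
        then show ?thesis using that D_hom[of p k q] t by (simp add: \<tau>_def L_def n_def)
      qed
      have "homogeneous (\<tau> (Suc i) ! (q - n (Suc i)) - \<delta> i ! p) (g i)" if "q \<ge> n (Suc i)" "p = q - n (Suc i)"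
      proof -
        have "q - n (Suc i) < length (\<delta> i)" using q that by (simp add: n_def[of i])
        then show ?thesis using g_hom that(2) by (simp add: \<tau>_def)
      qed
      then show "homogeneous ((\<delta> (Suc i) @ \<tau> (Suc i)) ! q - (\<delta> i @ \<tau> i) ! p) (C i $$ (p, q))"
        unfolding index_C[OF p q] nth_append n_def[symmetric]
        using D_hom[of p i q] L_hom[of "p - n i" "q - n (Suc i)"] p q by auto
    qed
    show "\<exists>v\<in>carrier_vec (length (\<delta> 0 @ \<tau> 0)). s - \<epsilon> \<bullet> v \<in> {j + f * g | j g. j \<in> J}" for s
    proof -
      obtain v where v: "v \<in> carrier_vec (n 0)" "s - \<epsilon> \<bullet> v \<in> J"
        using mfr_surjective[OF F] unfolding n_def by blast
      have "s - \<epsilon> \<bullet> v = (s - \<epsilon> \<bullet> v) + f * 0" by simp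
      then have "s - \<epsilon> \<bullet> v \<in> {j + f * g | j g. j \<in> J}" using v(2) by blast
      moreover have "v \<in> carrier_vec (length (\<delta> 0 @ \<tau> 0))" unfolding length t using v(1) by simp
      ultimately show ?thesis by (rule bexI)
    qed
    show "\<epsilon> \<bullet> v \<in> {j + f * g | j g. j \<in> J} \<longleftrightarrow> (\<exists>w\<in>carrier_vec (length (\<delta> 1 @ \<tau> 1)). v = C 0 *\<^sub>v w)"
      if "v \<in> carrier_vec (length (\<delta> 0 @ \<tau> 0))" for v
    proof -
      have v: "v \<in> carrier_vec (n 0)" using that unfolding length t by simp
      have C0: "C 0 *\<^sub>v (u @\<^sub>v w) = D 0 *\<^sub>v u + f \<cdot>\<^sub>v w"
        if u: "u \<in> carrier_vec (n (Suc 0))" and w: "w \<in> carrier_vec (n 0)" for u w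
      proof -
        have "L 0 *\<^sub>v w \<in> carrier_vec 0" using mult_mat_vec_carrier[OF cL w] t by simp
        then show ?thesis unfolding mult_C[OF u w] by (simp add: append_vec_empty g_def)
      qed
      have \<epsilon>_C0: "\<epsilon> \<bullet> (D 0 *\<^sub>v u + f \<cdot>\<^sub>v w) = \<epsilon> \<bullet> (D 0 *\<^sub>v u) + f * (\<epsilon> \<bullet> w)"
        if u: "u \<in> carrier_vec (n (Suc 0))" and w: "w \<in> carrier_vec (n 0)" for u w
        using scalar_prod_add_distrib[OF \<epsilon> mult_mat_vec_carrier[OF cD u], of "f \<cdot>\<^sub>v w"] w
          scalar_prod_smult_distrib[OF \<epsilon> w, of f] by simp
      show ?thesis
      proof
        assume "\<epsilon> \<bullet> v \<in> {j + f * g | j g. j \<in> J}"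
        then obtain j h where j: "j \<in> J" "\<epsilon> \<bullet> v = j + f * h" by blast
        obtain w where w: "w \<in> carrier_vec (n 0)" "h - \<epsilon> \<bullet> w \<in> J"
          using mfr_surjective[OF F] unfolding n_def by blast
        have fw: "f \<cdot>\<^sub>v w \<in> carrier_vec (n 0)" using w(1) by simp
        have "\<epsilon> \<bullet> (v - f \<cdot>\<^sub>v w) = j + f * (h - \<epsilon> \<bullet> w)"
          using scalar_prod_minus_distrib[OF \<epsilon> v fw] scalar_prod_smult_distrib[OF \<epsilon> w(1), of f] j(2)
          by (simp add: right_diff_distrib)
        then have "\<epsilon> \<bullet> (v - f \<cdot>\<^sub>v w) \<in> J"
          using ideal.subspace_add[OF J j(1) ideal.subspace_scale[OF J w(2)]] by simp
        moreover have "v - f \<cdot>\<^sub>v w \<in> carrier_vec (n 0)" using v fw by simp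
        ultimately obtain u where u: "u \<in> carrier_vec (n (Suc 0))" "v - f \<cdot>\<^sub>v w = D 0 *\<^sub>v u"
          using exact_0 by blast
        have "v = (v - f \<cdot>\<^sub>v w) + f \<cdot>\<^sub>v w" using v fw by (intro eq_vecI) auto
        then have "v = C 0 *\<^sub>v (u @\<^sub>v w)" unfolding C0[OF u(1) w(1)] u(2) .
        moreover have "u @\<^sub>v w \<in> carrier_vec (length (\<delta> 1 @ \<tau> 1))"
          unfolding length One_nat_def t using u(1) w(1) by simp
        ultimately show "\<exists>w\<in>carrier_vec (length (\<delta> 1 @ \<tau> 1)). v = C 0 *\<^sub>v w" by blast
      next
        assume "\<exists>w\<in>carrier_vec (length (\<delta> 1 @ \<tau> 1)). v = C 0 *\<^sub>v w"
        then obtain z where z: "z \<in> carrier_vec (n (Suc 0) + n 0)" "v = C 0 *\<^sub>v z"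
          unfolding length One_nat_def t by blast
        from z(1) obtain u w where u: "u \<in> carrier_vec (n (Suc 0))" and w: "w \<in> carrier_vec (n 0)"
          and uw: "z = u @\<^sub>v w" by (rule carrier_vec_add_split)
        have "\<epsilon> \<bullet> (D 0 *\<^sub>v u) \<in> J" using exact_0[OF mult_mat_vec_carrier[OF cD u]] u by blast
        moreover have "\<epsilon> \<bullet> v = \<epsilon> \<bullet> (D 0 *\<^sub>v u) + f * (\<epsilon> \<bullet> w)"
          unfolding z(2) uw C0[OF u w] by (rule \<epsilon>_C0[OF u w])
        ultimately show "\<epsilon> \<bullet> v \<in> {j + f * g | j g. j \<in> J}" by blast
      qed
    qed
    show "C i *\<^sub>v v = 0\<^sub>v (length (\<delta> i @ \<tau> i)) \<longleftrightarrow>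
        (\<exists>w\<in>carrier_vec (length (\<delta> (Suc (Suc i)) @ \<tau> (Suc (Suc i)))). v = C (Suc i) *\<^sub>v w)"
      if v: "v \<in> carrier_vec (length (\<delta> (Suc i) @ \<tau> (Suc i)))" for i v
    proof -
      from v have "v \<in> carrier_vec (n (Suc i) + n i)" unfolding length t .
      then obtain u w where u: "u \<in> carrier_vec (n (Suc i))" and w: "w \<in> carrier_vec (n i)"
        and uw: "v = u @\<^sub>v w" by (rule carrier_vec_add_split)
      have split_zero: "C i *\<^sub>v v = 0\<^sub>v (length (\<delta> i @ \<tau> i)) \<longleftrightarrow>
          D i *\<^sub>v u + g i \<cdot>\<^sub>v w = 0\<^sub>v (n i) \<and> L i *\<^sub>v w = 0\<^sub>v (t i)"
        unfolding uw mult_C[OF u w] length append_zero_vec[symmetric]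
        by (rule append_vec_eq[OF carrier_top[OF u w] zero_carrier_vec])
      have C_Suc: "C (Suc i) *\<^sub>v (x @\<^sub>v y) = (D (Suc i) *\<^sub>v x + g (Suc i) \<cdot>\<^sub>v y) @\<^sub>v (D i *\<^sub>v y)"
        if "x \<in> carrier_vec (n (Suc (Suc i)))" "y \<in> carrier_vec (n (Suc i))" for x y
        using mult_C[OF that] by (simp add: L_def)
      have D_lin: "D i *\<^sub>v (x + c \<cdot>\<^sub>v y) = D i *\<^sub>v x + c \<cdot>\<^sub>v (D i *\<^sub>v y)"
        if x: "x \<in> carrier_vec (n (Suc i))" and y: "y \<in> carrier_vec (n (Suc i))" for x y c
        using mult_add_distrib_mat_vec[OF cD x, of "c \<cdot>\<^sub>v y"] y mult_mat_vec_smult[OF cD y, of c] by simp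
      show ?thesis
      proof
        assume "C i *\<^sub>v v = 0\<^sub>v (length (\<delta> i @ \<tau> i))"
        then have top: "D i *\<^sub>v u + g i \<cdot>\<^sub>v w = 0\<^sub>v (n i)" and bot: "L i *\<^sub>v w = 0\<^sub>v (t i)"
          unfolding split_zero by blast+
        (* The only place where regularity of f enters is i = 0, where it replaces exactness of F. *)
        have "\<exists>y\<in>carrier_vec (n (Suc i)). w = D i *\<^sub>v y"
        proof (cases i)
          case 0
          have w0: "w \<in> carrier_vec (n 0)" and u0: "u \<in> carrier_vec (n (Suc 0))" using u w 0 by auto
          have fw: "f \<cdot>\<^sub>v w \<in> carrier_vec (n 0)" using w0 by simp
          have "0 = \<epsilon> \<bullet> (D 0 *\<^sub>v u + f \<cdot>\<^sub>v w)" using top \<epsilon> 0 by (simp add: g_def)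
          also have "\<dots> = \<epsilon> \<bullet> (D 0 *\<^sub>v u) + f * (\<epsilon> \<bullet> w)"
            using scalar_prod_add_distrib[OF \<epsilon> mult_mat_vec_carrier[OF cD u0] fw]
              scalar_prod_smult_distrib[OF \<epsilon> w0, of f] by simp
          finally have "f * (\<epsilon> \<bullet> w) = - (\<epsilon> \<bullet> (D 0 *\<^sub>v u))" by (simp add: eq_neg_iff_add_eq_0 add.commute)
          moreover have "\<epsilon> \<bullet> (D 0 *\<^sub>v u) \<in> J" using exact_0[OF mult_mat_vec_carrier[OF cD u0]] u0 by blast
          ultimately have "f * (\<epsilon> \<bullet> w) \<in> J" using ideal.subspace_neg[OF J] by simp
          then have "\<epsilon> \<bullet> w \<in> J" by (rule regular)
          then show ?thesis using exact_0[OF w0] 0 by simp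
        next
          case (Suc k)
          then have "D k *\<^sub>v w = 0\<^sub>v (n k)" using bot t by (simp add: L_def)
          then show ?thesis using exact[of w k] w Suc by simp
        qed
        then obtain y where y: "y \<in> carrier_vec (n (Suc i))" and wy: "w = D i *\<^sub>v y" by blast
        have "D i *\<^sub>v (u + g i \<cdot>\<^sub>v y) = 0\<^sub>v (n i)" unfolding D_lin[OF u y] using top wy by simp
        moreover have "u + g i \<cdot>\<^sub>v y \<in> carrier_vec (n (Suc i))" using u y by simp
        ultimately obtain x where x: "x \<in> carrier_vec (n (Suc (Suc i)))" "u + g i \<cdot>\<^sub>v y = D (Suc i) *\<^sub>v x"
          using exact by blast
        have "u = (u + g i \<cdot>\<^sub>v y) + g (Suc i) \<cdot>\<^sub>v y" using u y by (intro eq_vecI) (auto simp: g_Suc)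
        then have "v = C (Suc i) *\<^sub>v (x @\<^sub>v y)" unfolding C_Suc[OF x(1) y] x(2) uw wy by simp
        moreover have "x @\<^sub>v y \<in> carrier_vec (length (\<delta> (Suc (Suc i)) @ \<tau> (Suc (Suc i))))"
          unfolding length t using x(1) y by simp
        ultimately show "\<exists>w\<in>carrier_vec (length (\<delta> (Suc (Suc i)) @ \<tau> (Suc (Suc i)))). v = C (Suc i) *\<^sub>v w" by blast
      next
        assume "\<exists>w\<in>carrier_vec (length (\<delta> (Suc (Suc i)) @ \<tau> (Suc (Suc i)))). v = C (Suc i) *\<^sub>v w"
        then obtain z where z: "z \<in> carrier_vec (n (Suc (Suc i)) + n (Suc i))" "v = C (Suc i) *\<^sub>v z"
          unfolding length t by blast
        from z(1) obtain x y where x: "x \<in> carrier_vec (n (Suc (Suc i)))" and y: "y \<in> carrier_vec (n (Suc i))"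
          and xy: "z = x @\<^sub>v y" by (rule carrier_vec_add_split)
        have "u @\<^sub>v w = (D (Suc i) *\<^sub>v x + g (Suc i) \<cdot>\<^sub>v y) @\<^sub>v (D i *\<^sub>v y)"
          using z(2) unfolding uw xy C_Suc[OF x y] .
        then have eq: "u = D (Suc i) *\<^sub>v x + g (Suc i) \<cdot>\<^sub>v y" "w = D i *\<^sub>v y"
          using append_vec_eq[OF u carrier_top[OF x y]] by auto
        have Dx: "D (Suc i) *\<^sub>v x \<in> carrier_vec (n (Suc i))" by (rule mult_mat_vec_carrier[OF cD x])
        have "D i *\<^sub>v (D (Suc i) *\<^sub>v x) = 0\<^sub>v (n i)" using exact[OF Dx] x by blast
        then have "D i *\<^sub>v u + g i \<cdot>\<^sub>v w = (0\<^sub>v (n i) + g (Suc i) \<cdot>\<^sub>v w) + g i \<cdot>\<^sub>v w"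
          unfolding eq(1) D_lin[OF Dx y] eq(2)[symmetric] by simp
        also have "\<dots> = 0\<^sub>v (n i)" using w by (intro eq_vecI) (auto simp: g_Suc)
        finally have "D i *\<^sub>v u + g i \<cdot>\<^sub>v w = 0\<^sub>v (n i)" .
        moreover have "L i *\<^sub>v w = 0\<^sub>v (t i)"
        proof (cases i)
          case 0
          then have "L i *\<^sub>v w \<in> carrier_vec 0" using mult_mat_vec_carrier[OF cL w] t(1) by simp
          then have "L i *\<^sub>v w = 0\<^sub>v 0" by (rule carrier_vec_0)
          then show ?thesis using 0 t(1) by simp
        next
          case (Suc k)
          then have "D k *\<^sub>v w = 0\<^sub>v (n k)" using exact[of w k] w eq(2) y by blast
          then show ?thesis using Suc t by (simp add: L_def)
        qed
        ultimately show "C i *\<^sub>v v = 0\<^sub>v (length (\<delta> i @ \<tau> i))" unfolding split_zero by blast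
      qed
    qed
    show "C i $$ (p, q) \<in> irrelevant_ideal"
      if "p < length (\<delta> i @ \<tau> i)" "q < length (\<delta> (Suc i) @ \<tau> (Suc i))" for i p q
    proof -
      have p: "p < n i + t i" and q: "q < n (Suc i) + n i" using that unfolding length t .
      have D_irr: "D i $$ (p, q) \<in> irrelevant_ideal" if "p < n i" "q < n (Suc i)" for i p q
        using mfr_minimal[OF F] that unfolding n_def by blast
      have L_irr: "L i $$ (p, q) \<in> irrelevant_ideal" if "p < t i" "q < n i" for p q
        using that D_irr t by (cases i) (simp_all add: L_def)
      have "g i \<in> irrelevant_ideal" using homogeneous_in_irrelevant_ideal[OF g_hom] a by simp
      moreover have "0 \<in> (irrelevant_ideal :: ('v, 'k) mpoly set)"
        by (rule ideal.subspace_0[OF irrelevant_ideal_is_ideal])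
      ultimately show ?thesis
        unfolding index_C[OF p q] using D_irr[of p i q] L_irr[of "p - n i" "q - n (Suc i)"] p q by auto
    qed
  qed
  then show ?thesis unfolding \<tau>_def by blast
qed

section \<open>Regularity of complete intersections\<close>

lemma minimal_free_resolution_zero_ideal:
  "minimal_free_resolution {0 :: ('v::finite, 'k::comm_ring_1) mpoly}
     (\<lambda>i. if i = 0 then [0] else []) (vec 1 (\<lambda>_. 1)) (\<lambda>i. 0\<^sub>m (if i = 0 then 1 else 0) 0)"
  (is "minimal_free_resolution _ ?\<delta> ?\<epsilon> ?D")
proof (rule minimal_free_resolutionI)
  have \<epsilon>: "?\<epsilon> \<bullet> v = v $ 0" if "v \<in> carrier_vec 1" for v :: "('v, 'k) mpoly vec"
    using that by (simp add: scalar_prod_def)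
  show "\<exists>v\<in>carrier_vec (length (?\<delta> 0)). s - ?\<epsilon> \<bullet> v \<in> {0}" for s :: "('v, 'k) mpoly"
    using \<epsilon>[of "vec 1 (\<lambda>_. s)"] by (intro bexI[of _ "vec 1 (\<lambda>_. s)"]) auto
  show "?\<epsilon> \<bullet> v \<in> {0} \<longleftrightarrow> (\<exists>w\<in>carrier_vec (length (?\<delta> 1)). v = ?D 0 *\<^sub>v w)"
    if "v \<in> carrier_vec (length (?\<delta> 0))" for v :: "('v, 'k) mpoly vec"
  proof -
    have v: "v \<in> carrier_vec 1" using that by simp
    have "?\<epsilon> \<bullet> v \<in> {0} \<longleftrightarrow> v = 0\<^sub>v 1"
      unfolding \<epsilon>[OF v] using v by (auto intro!: eq_vecI)
    moreover have "0\<^sub>m 1 0 *\<^sub>v w = 0\<^sub>v 1" if "w \<in> carrier_vec 0" for w :: "('v, 'k) mpoly vec"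
      by (rule zero_mat_mult_vec[OF that])
    moreover have "(0\<^sub>v 0 :: ('v, 'k) mpoly vec) \<in> carrier_vec 0" by simp
    ultimately show ?thesis by (auto intro!: exI[of _ "0\<^sub>v 0"])
  qed
  show "?D i *\<^sub>v v = 0\<^sub>v (length (?\<delta> i)) \<longleftrightarrow> (\<exists>w\<in>carrier_vec (length (?\<delta> (Suc (Suc i)))). v = ?D (Suc i) *\<^sub>v w)"
    if "v \<in> carrier_vec (length (?\<delta> (Suc i)))" for i and v :: "('v, 'k) mpoly vec"
  proof -
    have v: "v \<in> carrier_vec 0" using that by simp
    have "?D i *\<^sub>v v = 0\<^sub>v (length (?\<delta> i))" using zero_mat_mult_vec[OF v] by simp
    moreover have "v = 0\<^sub>m 0 0 *\<^sub>v v" using v zero_mat_mult_vec[OF v, of 0] by auto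
    ultimately show ?thesis using v by auto
  qed
qed (auto simp: graded_mat_def)

text \<open>
  Each mapping cone moves the copy \<open>F(-a)\<close> up by \<open>a\<close> in degree and by one
  in homological degree, so the largest difference grows by \<open>a - 1\<close>; it is attained in
  the last homological degree.
\<close>

lemma koszul_resolution:
  fixes fs :: "('v::finite, 'k::comm_ring_1) mpoly list"
  assumes "list_all2 (\<lambda>a f. homogeneous (int a) f) as fs" "\<forall>a\<in>set as. 0 < a" "regular_sequence fs"
  shows "\<exists>\<delta> \<epsilon> D. minimal_free_resolution (ideal_generated_by (set fs)) \<delta> \<epsilon> D \<and>
    (\<forall>i. \<forall>j\<in>set (\<delta> i). j - int i \<le> int (sum_list as) - int (length as)) \<and>
    int (sum_list as) \<in> set (\<delta> (length as))"
  using assms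
proof (induction fs arbitrary: as rule: rev_induct)
  case Nil
  let ?\<delta> = "\<lambda>i::nat. if i = 0 then [0::int] else []"
  have "(\<forall>i. \<forall>j\<in>set (?\<delta> i). j - int i \<le> int (sum_list as) - int (length as)) \<and>
      int (sum_list as) \<in> set (?\<delta> (length as))"
    using Nil.prems(1) by simp
  moreover have "minimal_free_resolution (ideal_generated_by (set ([] :: ('v, 'k) mpoly list))) ?\<delta>
      (vec 1 (\<lambda>_. 1)) (\<lambda>i. 0\<^sub>m (if i = 0 then 1 else 0) 0)"
    using minimal_free_resolution_zero_ideal by simp
  ultimately show ?case by blast
next
  case (snoc f fs)
  then obtain as' a where as: "as = as' @ [a]" "list_all2 (\<lambda>a f. homogeneous (int a) f) as' fs"
    and f: "homogeneous (int a) f"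
    by (auto simp: list_all2_append2 list_all2_Cons2)
  have a: "a > 0" "\<forall>a\<in>set as'. 0 < a" using snoc.prems(2) as(1) by auto
  from snoc.IH[OF as(2) a(2) regular_sequence_snoc(1)[OF snoc.prems(3)]]
  obtain \<delta> \<epsilon> D where F: "minimal_free_resolution (ideal_generated_by (set fs)) \<delta> \<epsilon> D"
    and bound: "\<And>i j. j \<in> set (\<delta> i) \<Longrightarrow> j - int i \<le> int (sum_list as') - int (length as')"
    and attained: "int (sum_list as') \<in> set (\<delta> (length as'))" by blast
  let ?\<delta> = "\<lambda>i. \<delta> i @ (case i of 0 \<Rightarrow> [] | Suc k \<Rightarrow> map (\<lambda>d. d + int a) (\<delta> k))"
  obtain D' where "minimal_free_resolution (ideal_generated_by (set (fs @ [f]))) ?\<delta> \<epsilon> D'"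
    unfolding ideal_generated_by_snoc
    using mapping_cone[OF ideal.subspace_span F f _ regular_sequence_snoc(2)[OF snoc.prems(3)]] a(1) by auto
  moreover have "j - int i \<le> int (sum_list as) - int (length as)" if j: "j \<in> set (?\<delta> i)" for i j
  proof (cases "j \<in> set (\<delta> i)")
    case True
    then show ?thesis using bound[OF True] a(1) unfolding as(1) by simp
  next
    case False
    then obtain k d where "i = Suc k" "d \<in> set (\<delta> k)" "j = d + int a"
      using j by (cases i) auto
    then show ?thesis using bound[of d k] unfolding as(1) by simp
  qed
  moreover have "int (sum_list as) \<in> set (?\<delta> (length as))"
    using attained unfolding as(1) by simp
  ultimately show ?case by blast
qed

text \<open>
  By uniqueness of the degrees, one minimal resolution computes the supremum for all of them.
\<close>

lemma regularity_eqI: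
  assumes I: "graded_ideal I" and F: "minimal_free_resolution I \<delta> \<epsilon> D"
    and bound: "\<And>i j. j \<in> set (\<delta> i) \<Longrightarrow> j - int i \<le> r" and attained: "j \<in> set (\<delta> i)" "j - int i = r"
  shows "regularity I = ereal (real_of_int r)"
proof -
  have Sup: "Sup {ereal (real_of_int (j - int i)) | i j. j \<in> set (\<delta>' i)} = ereal (real_of_int r)"
    if G: "minimal_free_resolution I \<delta>' \<epsilon>' D'" for \<delta>' \<epsilon>' D'
  proof -
    have same: "set (\<delta>' i) = set (\<delta> i)" for i
      using resolution_degrees_subset[OF I F G] resolution_degrees_subset[OF I G F] by blast
    show ?thesis
    proof (rule antisym)
      show "Sup {ereal (real_of_int (j - int i)) | i j. j \<in> set (\<delta>' i)} \<le> ereal (real_of_int r)"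
      proof (rule Sup_least)
        fix x assume "x \<in> {ereal (real_of_int (j - int i)) | i j. j \<in> set (\<delta>' i)}"
        then obtain i j where x: "x = ereal (real_of_int (j - int i))" and "j \<in> set (\<delta> i)"
          unfolding same by blast
        from bound[OF this(2)] have "real_of_int (j - int i) \<le> real_of_int r" by (rule of_int_le_iff[THEN iffD2])
        then show "x \<le> ereal (real_of_int r)" unfolding x by simp
      qed
      show "ereal (real_of_int r) \<le> Sup {ereal (real_of_int (j - int i)) | i j. j \<in> set (\<delta>' i)}"
        unfolding same attained(2)[symmetric] using attained(1) by (intro Sup_upper) blast
    qed
  qed
  show ?thesis unfolding regularity_def
  proof (rule the_equality)
    show "\<exists>\<delta>' \<epsilon>' D'. minimal_free_resolution I \<delta>' \<epsilon>' D' \<and>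
        ereal (real_of_int r) = Sup {ereal (real_of_int (j - int i)) | i j. j \<in> set (\<delta>' i)}"
      by (intro exI conjI) (rule F, rule Sup[OF F, symmetric])
    fix x assume "\<exists>\<delta>' \<epsilon>' D'. minimal_free_resolution I \<delta>' \<epsilon>' D' \<and>
        x = Sup {ereal (real_of_int (j - int i)) | i j. j \<in> set (\<delta>' i)}"
    then obtain \<delta>' \<epsilon>' D' where G: "minimal_free_resolution I \<delta>' \<epsilon>' D'"
      and x: "x = Sup {ereal (real_of_int (j - int i)) | i j. j \<in> set (\<delta>' i)}" by (elim exE conjE)
    show "x = ereal (real_of_int r)" unfolding x by (rule Sup[OF G])
  qed
qed

lemma complete_intersectionE:
  assumes "complete_intersection n as I"
  obtains fs where "list_all2 (\<lambda>a f. homogeneous (int a) f) as fs" "regular_sequence fs"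
    "I = ideal_generated_by (set fs)"
proof -
  from assms obtain fs where "length fs = length as" "\<forall>i<length as. homogeneous (int (as ! i)) (fs ! i)"
    "regular_sequence fs" "I = ideal_generated_by (set fs)"
    unfolding complete_intersection_def by blast
  then show thesis by (intro that[of fs]) (simp_all add: list_all2_conv_all_nth)
qed

lemma regularity_complete_intersection:
  fixes I :: "('v::finite, 'k::field) mpoly set"
  assumes "complete_intersection n as I"
  shows "regularity I = ereal (real (sum_list as) - real (length as))"
proof -
  from assms obtain fs where fs: "list_all2 (\<lambda>a f. homogeneous (int a) f) as fs" "regular_sequence fs"
    "I = ideal_generated_by (set fs)" by (rule complete_intersectionE)
  have pos: "\<forall>a\<in>set as. 0 < a" using assms unfolding complete_intersection_def by blast
  have graded: "graded_ideal I"
    unfolding fs(3) using fs(1) by (intro graded_ideal_generated_by) (auto simp: list_all2_conv_all_nth in_set_conv_nth)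
  from koszul_resolution[OF fs(1) pos fs(2)] obtain \<delta> \<epsilon> D
    where F: "minimal_free_resolution I \<delta> \<epsilon> D"
    and "\<And>i j. j \<in> set (\<delta> i) \<Longrightarrow> j - int i \<le> int (sum_list as) - int (length as)"
    "int (sum_list as) \<in> set (\<delta> (length as))" unfolding fs(3) by blast
  from regularity_eqI[OF graded F this(2,3) refl] show ?thesis by simp
qed

lemma hilbert_series_complete_intersection:
  fixes I :: "('v::finite, 'k::field) mpoly set"
  assumes "complete_intersection n as I"
  shows "hilbert_series I = fps_of_poly (ci_numerator (mset as)) * inverse ((1 - fps_X) ^ CARD('v))"
proof -
  from assms obtain fs where "list_all2 (\<lambda>a f. homogeneous (int a) f) as fs" "regular_sequence fs"
    "I = ideal_generated_by (set fs)" by (rule complete_intersectionE)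
  then show ?thesis by (simp add: hilbert_series_regular_sequence fps_of_poly_ci_numerator)
qed

theorem corollary2p2:
  fixes X :: "('v::finite, 'k::{alg_closed_field, field_char_0}) mpoly set"
    and n :: nat and as :: "nat list"
  assumes "CARD('v) = n + 1"
    and "complete_intersection n as X"
  shows "(regularity X \<le> proj_dim X \<longleftrightarrow> sum_list as \<le> n) \<and>
    (regularity X \<le> proj_dim X \<longrightarrow>
      (\<forall>(Y :: ('v, 'k) mpoly set) bs.
         complete_intersection n bs Y \<and> hilbert_polynomial Y = hilbert_polynomial X \<longrightarrow>
         length bs = length as \<and> mset bs = mset as))"
proof -
  have X: "length as \<le> n" "\<forall>a\<in>#mset as. 0 < a" "proj_dim X = ereal (real (n - length as))"
    using assms(2) unfolding complete_intersection_def by simp_all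
  have reg: "regularity X \<le> proj_dim X \<longleftrightarrow> sum_list as \<le> n"
    unfolding regularity_complete_intersection[OF assms(2)] X(3) using X(1) by (simp add: of_nat_diff)
  moreover have "length bs = length as \<and> mset bs = mset as"
    if sum: "sum_list as \<le> n" and Y: "complete_intersection n bs Y" "hilbert_polynomial Y = hilbert_polynomial X"
    for Y :: "('v, 'k) mpoly set" and bs
  proof -
    have B: "size (mset bs) \<le> n" "\<forall>b\<in>#mset bs. 0 < b"
      using Y(1) unfolding complete_intersection_def by simp_all
    have "(1 - indet) ^ Suc n dvd ci_numerator (mset as) - ci_numerator (mset bs)"
      using same_hilbert_polynomial_imp_dvd[OF hilbert_series_complete_intersection[OF assms(2)]
          hilbert_series_complete_intersection[OF Y(1)] _ Y(2)[symmetric]] assms(1)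
      by (simp del: power_Suc)
    then have "mset as = mset bs"
      using X(1,2) B sum by (intro degrees_determined) (simp_all add: sum_mset_sum_list)
    then show ?thesis using mset_eq_length by metis
  qed
  ultimately show ?thesis by blast
qed

end
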